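(* Let $X$ be a Banach space and let $T\in B(X)$. Then: (i) $T$ is reiteratively distributionally chaotic of type $1$ if and only if there exist an irregular vector $x\in X$ for $T$ and a set $A\subset\mathbb N$ with $\overline{\mathrm{dens}}(A)>0$ such that $\lim_{n\to\infty,\,n\in A}T^nx=0$. (ii) $T$ is reiteratively distributionally chaotic of type $1^+$ if and only if there exists an irregular vector $x\in X$ for $T$ whose orbit is distributionally near to $0$. (iii) $T$ is reiteratively distributionally chaotic of type $2$ if and only if there exists an irregular vector $x\in X$ for $T$ whose orbit is distributionally unbounded.
   Context: $B(X)$ is the space of bounded linear operators $X\to X$. For $A\subset\mathbb N$, the lower and upper densities are $\underline{\mathrm{dens}}(A)=\liminf_{n\to\infty}\frac{\mathrm{card}(A\cap[1,n])}{n}$ and $\overline{\mathrm{dens}}(A)=\limsup_{n\to\infty}\frac{\mathrm{card}(A\cap[1,n])}{n}$; the Banach upper and lower densities are $\overline{\mathrm{Bd}}(A)=\lim_{n\to\infty}\limsup_{m\to\infty}\frac{\mathrm{card}(A\cap[m+1,m+n])}{n}$ and $\underline{\mathrm{Bd}}(A)=\lim_{n\to\infty}\liminf_{m\to\infty}\frac{\mathrm{card}(A\cap[m+1,m+n])}{n}$. For $x,y\in X$ and $\delta>0$ put $D_{x,y}(\delta)=\{j\in\mathbb N:\|T^jx-T^jy\|<\delta\}$ and $F_{x,y}(\delta)=\underline{\mathrm{dens}}(D_{x,y}(\delta))$, $F^*_{x,y}(\delta)=\overline{\mathrm{dens}}(D_{x,y}(\delta))$, $BF_{x,y}(\delta)=\underline{\mathrm{Bd}}(D_{x,y}(\delta))$,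 $BF^*_{x,y}(\delta)=\overline{\mathrm{Bd}}(D_{x,y}(\delta))$. Writing "$\equiv 1$" means equality to $1$ for all $\delta>0$. $T$ is reiteratively distributionally chaotic of type $1$ if there exist an uncountable set $\Gamma\subset X$ and $\varepsilon>0$ such that for every pair $(x,y)\in\Gamma\times\Gamma$ of distinct points, $BF_{x,y}(\varepsilon)=0$ and there exist $c>0$ and $r>0$ with $c\le F^*_{x,y}(\delta)$ for all $0<\delta<r$. It is of type $1^+$ if there exist an uncountable $\Gamma\subset X$ and $\varepsilon>0$ such that for all distinct $x,y\in\Gamma$, $BF_{x,y}(\varepsilon)=0$ and $F^*_{x,y}\equiv1$. It is of type $2$ if there exist an uncountable $\Gamma\subset X$ and $\varepsilon>0$ such that for all distinct $x,y\in\Gamma$, $BF^*_{x,y}\equiv1$ and $F_{x,y}(\varepsilon)<1$. A vector $x$ is irregular for $T$ if $\liminf_{n\to\infty}\|T^nx\|=0$ and $\limsup_{n\to\infty}\|T^nx\|=\infty$. The orbit of $x$ is distributionally near to $0$ if there is $A\subset\mathbb N$ with $\overline{\mathrm{dens}}(A)=1$ and $\lim_{n\in A}T^nx=0$; it is distributionally unbounded if there is $B\subset\mathbb N$ with $\overline{\mathrm{dens}}(B)=1$ and $\lim_{n\in B}\|T^nx\|=\infty$. *)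

theory Defs
  imports "HOL-Analysis.Analysis"
begin

text \<open>
  Densities take values in \<^typ>\<open>ereal\<close>, so that \<^const>\<open>liminf\<close> and \<^const>\<open>limsup\<close> apply. Only
  positive integers are counted, so whether a set of naturals contains \<open>0\<close> is irrelevant.
  The quotients at \<open>n = 0\<close> (where \<open>x / 0 = 0\<close>) do not affect any of the limits.
\<close>

definition lower_density :: "nat set \<Rightarrow> ereal" where
  "lower_density A = liminf (\<lambda>n. ereal (real (card (A \<inter> {1..n})) / real n))"

definition upper_density :: "nat set \<Rightarrow> ereal" where
  "upper_density A = limsup (\<lambda>n. ereal (real (card (A \<inter> {1..n})) / real n))"

text \<open>
  The outer limits exist for every \<open>A\<close> by Fekete's lemma: \<open>n\<close> times the inner \<open>limsup\<close> is
  subadditive in \<open>n\<close>, and \<open>n\<close> times the inner \<open>liminf\<close> is superadditive. Hence \<^const>\<open>lim\<close>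
  below never denotes an unspecified value.
\<close>

definition lower_Banach_density :: "nat set \<Rightarrow> ereal" where
  "lower_Banach_density A =
     lim (\<lambda>n. liminf (\<lambda>m. ereal (real (card (A \<inter> {m+1..m+n})) / real n)))"

definition upper_Banach_density :: "nat set \<Rightarrow> ereal" where
  "upper_Banach_density A =
     lim (\<lambda>n. limsup (\<lambda>m. ereal (real (card (A \<inter> {m+1..m+n})) / real n)))"

definition close_times :: "('a::real_normed_vector \<Rightarrow> 'a) \<Rightarrow> 'a \<Rightarrow> 'a \<Rightarrow> real \<Rightarrow> nat set" where
  "close_times T x y \<delta> = {j. norm ((T ^^ j) x - (T ^^ j) y) < \<delta>}"

definition F_lower :: "('a::real_normed_vector \<Rightarrow> 'a) \<Rightarrow> 'a \<Rightarrow> 'a \<Rightarrow> real \<Rightarrow> ereal" where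
  "F_lower T x y \<delta> = lower_density (close_times T x y \<delta>)"

definition F_upper :: "('a::real_normed_vector \<Rightarrow> 'a) \<Rightarrow> 'a \<Rightarrow> 'a \<Rightarrow> real \<Rightarrow> ereal" where
  "F_upper T x y \<delta> = upper_density (close_times T x y \<delta>)"

definition BF_lower :: "('a::real_normed_vector \<Rightarrow> 'a) \<Rightarrow> 'a \<Rightarrow> 'a \<Rightarrow> real \<Rightarrow> ereal" where
  "BF_lower T x y \<delta> = lower_Banach_density (close_times T x y \<delta>)"

definition BF_upper :: "('a::real_normed_vector \<Rightarrow> 'a) \<Rightarrow> 'a \<Rightarrow> 'a \<Rightarrow> real \<Rightarrow> ereal" where
  "BF_upper T x y \<delta> = upper_Banach_density (close_times T x y \<delta>)"

definition RDC_type_1 :: "('a::real_normed_vector \<Rightarrow> 'a) \<Rightarrow> bool" where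
  "RDC_type_1 T \<longleftrightarrow> (\<exists>\<Gamma> \<epsilon>. uncountable \<Gamma> \<and> \<epsilon> > 0 \<and>
     (\<forall>x\<in>\<Gamma>. \<forall>y\<in>\<Gamma>. x \<noteq> y \<longrightarrow>
        BF_lower T x y \<epsilon> = 0 \<and>
        (\<exists>c>0::real. \<exists>r>0::real. \<forall>\<delta>. 0 < \<delta> \<and> \<delta> < r \<longrightarrow> ereal c \<le> F_upper T x y \<delta>)))"

definition RDC_type_1_plus :: "('a::real_normed_vector \<Rightarrow> 'a) \<Rightarrow> bool" where
  "RDC_type_1_plus T \<longleftrightarrow> (\<exists>\<Gamma> \<epsilon>. uncountable \<Gamma> \<and> \<epsilon> > 0 \<and>
     (\<forall>x\<in>\<Gamma>. \<forall>y\<in>\<Gamma>. x \<noteq> y \<longrightarrow>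
        BF_lower T x y \<epsilon> = 0 \<and> (\<forall>\<delta>>0. F_upper T x y \<delta> = 1)))"

definition RDC_type_2 :: "('a::real_normed_vector \<Rightarrow> 'a) \<Rightarrow> bool" where
  "RDC_type_2 T \<longleftrightarrow> (\<exists>\<Gamma> \<epsilon>. uncountable \<Gamma> \<and> \<epsilon> > 0 \<and>
     (\<forall>x\<in>\<Gamma>. \<forall>y\<in>\<Gamma>. x \<noteq> y \<longrightarrow>
        (\<forall>\<delta>>0. BF_upper T x y \<delta> = 1) \<and> F_lower T x y \<epsilon> < 1))"

definition irregular_vector :: "('a::real_normed_vector \<Rightarrow> 'a) \<Rightarrow> 'a \<Rightarrow> bool" where
  "irregular_vector T x \<longleftrightarrow>
     liminf (\<lambda>n. ereal (norm ((T ^^ n) x))) = 0 \<and>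
     limsup (\<lambda>n. ereal (norm ((T ^^ n) x))) = \<infinity>"

text \<open>
  The limit as \<open>n \<rightarrow> \<infinity>\<close> with \<open>n \<in> A\<close> is taken along this filter. It is trivial for finite \<open>A\<close>,
  but it is only used for sets of positive upper density, which are infinite.
\<close>

abbreviation sequentially_in :: "nat set \<Rightarrow> nat filter" where
  "sequentially_in A \<equiv> inf sequentially (principal A)"

definition distributionally_near_0 :: "('a::real_normed_vector \<Rightarrow> 'a) \<Rightarrow> 'a \<Rightarrow> bool" where
  "distributionally_near_0 T x \<longleftrightarrow>
     (\<exists>A. upper_density A = 1 \<and> ((\<lambda>n. (T ^^ n) x) \<longlongrightarrow> 0) (sequentially_in A))"

definition distributionally_unbounded :: "('a::real_normed_vector \<Rightarrow> 'a) \<Rightarrow> 'a \<Rightarrow> bool" where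
  "distributionally_unbounded T x \<longleftrightarrow>
     (\<exists>B. upper_density B = 1 \<and> filterlim (\<lambda>n. norm ((T ^^ n) x)) at_top (sequentially_in B))"

end

theory Submission
  imports Defs
begin

text \<open>
  For an irregular vector \<open>x\<close> the line spanned by \<open>x\<close> is scrambled. Conversely, let \<open>u\<close> be the
  difference of a scrambled pair and \<open>Y\<close> the space of vectors whose orbits tend to \<open>0\<close> along the
  same times as that of \<open>u\<close>. The required smallness of orbits holds on \<open>Y\<close> and is a \<open>G\<^sub>\<delta>\<close> property;
  the required largeness is a \<open>G\<^sub>\<delta>\<close> property that is dense by perturbation, since
  iterates of \<open>u\<close> start from arbitrarily small vectors and become large again. Baire's theorem in
  the closure of \<open>Y\<close> then yields the irregular vector. For type 2, the orbit of \<open>u\<close> is large only on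
  a set of positive upper density; the proportion is raised to \<open>1\<close> by the submultiplicativity
  of the maximal proportion of time that an orbit starting in the unit ball spends above a level.
\<close>

section \<open>Density\<close>

lemma card_Int_interval_le: "card (A \<inter> {1..n::nat}) \<le> n"
  using card_mono[of "{1..n}" "A \<inter> {1..n}"] by simp

lemma upper_density_le_1: "upper_density A \<le> 1"
proof -
  have "ereal (real (card (A \<inter> {1..n})) / real n) \<le> 1" for n
    using card_Int_interval_le[of A n] by (cases "n = 0") (simp_all flip: one_ereal_def)
  then show ?thesis
    unfolding upper_density_def by (intro Limsup_bounded) auto
qed

text \<open>For a fixed \<open>n\<close> the right-hand side restricts only finitely many times.
  With \<open>e = 1 / (k + 1)\<close> and \<open>N = k\<close> it becomes a countable family of
  finite counts, the form that the Baire arguments can handle.\<close>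

lemma upper_density_ge_iff:
  "ereal c \<le> upper_density A \<longleftrightarrow>
     (\<forall>e>0. \<forall>N. \<exists>n\<ge>N. (c - e) * real n < real (card (A \<inter> {1..n})))" (is "?L \<longleftrightarrow> ?R")
proof
  assume L: ?L
  show ?R
  proof (intro allI impI)
    fix e :: real and N :: nat assume "e > 0"
    show "\<exists>n\<ge>N. (c - e) * real n < real (card (A \<inter> {1..n}))"
    proof (rule ccontr)
      assume "\<not> ?thesis"
      then have *: "\<forall>n\<ge>N. real (card (A \<inter> {1..n})) \<le> (c - e) * real n"
        by force
      have "upper_density A \<le> ereal (c - e)"
        unfolding upper_density_def
      proof (intro Limsup_bounded eventually_sequentiallyI[of "max N 1"])
        fix n assume "max N 1 \<le> n"
        with * show "ereal (real (card (A \<inter> {1..n})) / real n) \<le> ereal (c - e)"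
          by (simp add: divide_le_eq)
      qed
      with L \<open>e > 0\<close> have "ereal c \<le> ereal (c - e)"
        by (meson order_trans)
      with \<open>e > 0\<close> show False by simp
    qed
  qed
next
  assume R: ?R
  show ?L
  proof (rule ccontr)
    assume "\<not> ?L"
    then obtain c' where c': "upper_density A < ereal c'" "c' < c"
      by (metis ereal_dense2 ereal_less_ereal_Ex not_le less_ereal.simps(1))
    from Limsup_lessD[OF c'(1)[unfolded upper_density_def]]
    obtain N where N: "\<And>n. n \<ge> N \<Longrightarrow> real (card (A \<inter> {1..n})) / real n < c'"
      unfolding eventually_sequentially by auto
    from R c'(2) obtain n where n: "n \<ge> max N 1" "(c - (c - c')) * real n < real (card (A \<inter> {1..n}))"
      by (metis diff_gt_0_iff_gt)
    with N[of n] show False by (simp add: divide_less_eq)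
  qed
qed

text \<open>The finitely many elements outside \<open>B\<close> are absorbed by
  \<open>e / 2 * n\<close> once \<open>n\<close> is large. With \<open>B\<close> a set of times of
  small norm, convergence to 0 along \<open>A\<close> becomes a density bound.\<close>

lemma upper_density_ge_almost_mono:
  assumes c: "ereal c \<le> upper_density A" and fin: "finite (A - B)"
  shows "ereal c \<le> upper_density B"
  unfolding upper_density_ge_iff
proof (intro allI impI)
  fix e :: real and N :: nat assume "e > 0"
  define F where "F = card (A - B)"
  obtain N' :: nat where N': "2 * real F / e < real N'" using reals_Archimedean2 by blast
  have "\<exists>n\<ge>max N N'. (c - e / 2) * real n < real (card (A \<inter> {1..n}))"
    using c \<open>e > 0\<close> unfolding upper_density_ge_iff by (meson half_gt_zero)
  then obtain n where n: "n \<ge> N" "n \<ge> N'" "(c - e / 2) * real n < real (card (A \<inter> {1..n}))"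
    by auto
  have "card (A \<inter> {1..n}) \<le> card ((B \<inter> {1..n}) \<union> (A - B))"
    using fin by (intro card_mono) auto
  also have "\<dots> \<le> card (B \<inter> {1..n}) + F"
    unfolding F_def by (rule card_Un_le)
  finally have 1: "real (card (A \<inter> {1..n})) \<le> real (card (B \<inter> {1..n})) + real F" by linarith
  have "2 * real F / e < real n" using N' n(2) by linarith
  then have "real F < e / 2 * real n"
    using \<open>e > 0\<close> by (simp add: field_simps)
  with 1 n(3) have "(c - e) * real n < real (card (B \<inter> {1..n}))"
    by (simp add: algebra_simps)
  with n(1) show "\<exists>n\<ge>N. (c - e) * real n < real (card (B \<inter> {1..n}))" by blast
qed

lemma upper_density_pos_imp_infinite:
  assumes "0 < ereal c" "ereal c \<le> upper_density A"
  shows "infinite A"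
proof
  assume "finite A"
  then have "ereal c \<le> upper_density {}"
    using upper_density_ge_almost_mono assms(2) by simp
  moreover have "upper_density {} = 0"
    by (simp add: upper_density_def Limsup_const flip: zero_ereal_def)
  ultimately show False using assms(1) by simp
qed

text \<open>One witness per level suffices: a witness for a later, smaller \<open>S l\<close> also
  serves \<open>S k\<close>, with a larger \<open>n\<close> and a smaller error.\<close>

lemma upper_density_ge_antimono:
  fixes S :: "nat \<Rightarrow> nat set"
  assumes S: "antimono S"
    and ex: "\<And>k. \<exists>n\<ge>k. (c - 1 / (real k + 1)) * real n < real (card (S k \<inter> {1..n}))"
  shows "ereal c \<le> upper_density (S k)"
  unfolding upper_density_ge_iff
proof (intro allI impI)
  fix e :: real and N :: nat assume "e > 0"
  obtain k0 :: nat where k0: "1 / e < real k0" using reals_Archimedean2 by blast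
  \<comment> \<open>The three bounds give, in turn, \<open>S l \<subseteq> S k\<close>, an error
    below \<open>e\<close>, and a witness beyond \<open>N\<close>.\<close>
  define l where "l = max k (max k0 N)"
  obtain n where n: "n \<ge> l" "(c - 1 / (real l + 1)) * real n < real (card (S l \<inter> {1..n}))"
    using ex by blast
  have "1 / e < real l + 1" using k0 by (simp add: l_def)
  then have "1 / (real l + 1) < e" using \<open>e > 0\<close> by (simp add: field_simps)
  then have "(c - e) * real n \<le> (c - 1 / (real l + 1)) * real n"
    by (intro mult_right_mono) auto
  also note n(2)
  also have "card (S l \<inter> {1..n}) \<le> card (S k \<inter> {1..n})"
    using antimonoD[OF S, of k l] by (intro card_mono) (auto simp: l_def)
  finally have "(c - e) * real n < real (card (S k \<inter> {1..n}))" by simp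
  moreover have "n \<ge> N" using n(1) by (simp add: l_def)
  ultimately show "\<exists>n\<ge>N. (c - e) * real n < real (card (S k \<inter> {1..n}))" by blast
qed

text \<open>\<open>A\<close> follows \<open>S (Suc k)\<close> on the block from \<open>n k\<close>
  to \<open>n (Suc k)\<close>. The blocks grow so fast that everything before \<open>n k\<close> is
  a negligible part of the segment up to \<open>n (Suc k)\<close>.\<close>

lemma upper_density_diagonal:
  fixes S :: "nat \<Rightarrow> nat set"
  assumes S: "antimono S" and c: "\<And>k. ereal c \<le> upper_density (S k)"
  shows "\<exists>A. ereal c \<le> upper_density A \<and> (\<forall>k. finite (A - S k))"
proof -
  define P where "P k m \<longleftrightarrow> (c - 1 / (real k + 1)) * real m < real (card (S k \<inter> {1..m}))" for k m
  have ex: "\<exists>m\<ge>N. P k m" for k N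
    using c[of k] unfolding upper_density_ge_iff P_def by (meson of_nat_0_less_iff divide_pos_pos
      zero_less_one add_nonneg_pos of_nat_0_le_iff)
  \<comment> \<open>The factor \<open>k + 2\<close> makes \<open>n k\<close> at most the proportion
    \<open>1 / (k + 2)\<close> of \<open>n (Suc k)\<close>; the summand 1 gives strict
    growth.\<close>
  have "\<exists>n. \<forall>k. P k (n k) \<and> Suc k \<le> n k \<and> (k + 2) * n k + 1 \<le> n (Suc k)"
  proof (rule exE[OF dependent_nat_choice[of "\<lambda>k m. P k m \<and> Suc k \<le> m" "\<lambda>k m m'. (k + 2) * m + 1 \<le> m'"]])
    show "\<exists>m. P 0 m \<and> Suc 0 \<le> m" using ex by metis
    show "\<exists>m'. (P (Suc k) m' \<and> Suc (Suc k) \<le> m') \<and> (k + 2) * m + 1 \<le> m'" for k m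
      using ex[of "max (Suc (Suc k)) ((k + 2) * m + 1)" "Suc k"] by auto
  qed blast
  then obtain n where n: "\<And>k. P k (n k)" "\<And>k. Suc k \<le> n k"
    and n_Suc: "\<And>k. (k + 2) * n k + 1 \<le> n (Suc k)" by blast
  have "n k < n (Suc k)" for k
    using n_Suc[of k] by simp
  then have mono: "strict_mono n" by (simp add: strict_mono_Suc_iff)
  \<comment> \<open>Since \<open>S\<close> decreases, of all the conditions on a \<open>j\<close> in
    the block after \<open>n k\<close> the one for \<open>k\<close> is the strongest.\<close>
  define A where "A = {j. \<forall>k. n k < j \<longrightarrow> j \<in> S (Suc k)}"
  have "finite (A - S k)" for k
  proof (rule finite_subset)
    show "A - S k \<subseteq> {..n k}"
    proof
      fix j assume "j \<in> A - S k"
      then have "j \<notin> S (Suc k)" "n k < j \<longrightarrow> j \<in> S (Suc k)"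
        using antimonoD[OF S, of k "Suc k"] by (auto simp: A_def)
      then show "j \<in> {..n k}" by auto
    qed
  qed auto
  moreover have "ereal c \<le> upper_density A"
    unfolding upper_density_ge_iff
  proof (intro allI impI)
    fix e :: real and N :: nat assume "e > 0"
    obtain k0 :: nat where "2 / e < real k0" using reals_Archimedean2 by blast
    then obtain k where k: "2 / e < real k" "k \<ge> N"
      using that[of "max k0 N"] by (simp add: of_nat_max)
    let ?m = "n (Suc k)"
    have sub: "S (Suc k) \<inter> {1..?m} \<subseteq> (A \<inter> {1..?m}) \<union> {1..n k}"
    proof
      fix j assume j: "j \<in> S (Suc k) \<inter> {1..?m}"
      have "j \<in> S (Suc i)" if "n i < j" for i
      proof -
        have "n i < ?m" using that j by auto
        then have "Suc i \<le> Suc k" using mono by (simp add: strict_mono_less)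
        then show ?thesis using antimonoD[OF S, of "Suc i" "Suc k"] j by auto
      qed
      with j show "j \<in> (A \<inter> {1..?m}) \<union> {1..n k}" by (auto simp: A_def)
    qed
    have "card (S (Suc k) \<inter> {1..?m}) \<le> card (A \<inter> {1..?m}) + n k"
      using card_mono[OF _ sub] card_Un_le[of "A \<inter> {1..?m}" "{1..n k}"] by simp
    then have 1: "real (card (S (Suc k) \<inter> {1..?m})) \<le> real (card (A \<inter> {1..?m})) + real (n k)"
      by linarith
    have "real ((k + 2) * n k + 1) \<le> real ?m" using n_Suc[of k] of_nat_mono by blast
    then have "(real k + 2) * real (n k) \<le> real ?m" by (simp add: algebra_simps)
    then have 2: "real (n k) \<le> 1 / (real k + 2) * real ?m"
      by (simp add: field_simps)
    have 3: "(c - 1 / (real k + 2)) * real ?m < real (card (S (Suc k) \<inter> {1..?m}))"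
      using n(1)[of "Suc k"] by (simp add: P_def add.commute)
    \<comment> \<open>One share \<open>1 / (k + 2)\<close> pays for the error in
      \<open>P (Suc k)\<close>, the other for the initial segment up to \<open>n k\<close>.\<close>
    have "2 / (real k + 2) \<le> e" using k(1) \<open>e > 0\<close>
      by (simp add: field_simps)
    then have "(c - e) * real ?m \<le> (c - 2 / (real k + 2)) * real ?m"
      by (intro mult_right_mono) auto
    also have "\<dots> = (c - 1 / (real k + 2)) * real ?m - 1 / (real k + 2) * real ?m"
      by (simp add: algebra_simps)
    also have "\<dots> < real (card (A \<inter> {1..?m}))" using 1 2 3 by linarith
    finally have "(c - e) * real ?m < real (card (A \<inter> {1..?m}))" .
    moreover have "?m \<ge> N" using n(2)[of "Suc k"] k by linarith
    ultimately show "\<exists>n\<ge>N. (c - e) * real n < real (card (A \<inter> {1..n}))" by blast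
  qed
  ultimately show ?thesis by blast
qed

text \<open>The counts of a set and of its complement in \<open>{1..n}\<close> add up to
  \<open>n\<close>. For close times, the complement consists of the times at which the difference
  has norm at least \<open>\<epsilon>\<close>.\<close>

lemma lower_density_less_1_iff:
  "lower_density D < 1 \<longleftrightarrow> (\<exists>\<beta>>0. ereal \<beta> \<le> upper_density (- D))"
proof -
  have card_compl: "real (card (- D \<inter> {1..n})) = real n - real (card (D \<inter> {1..n}))" for n
  proof -
    have "card (D \<inter> {1..n}) + card (- D \<inter> {1..n}) = card ((D \<inter> {1..n}) \<union> (- D \<inter> {1..n}))"
      by (rule card_Un_disjoint[symmetric]) auto
    also have "(D \<inter> {1..n}) \<union> (- D \<inter> {1..n}) = {1..n}" by blast
    finally show ?thesis by simp
  qed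
  show ?thesis
  proof
    assume "lower_density D < 1"
    then obtain q where q: "lower_density D < ereal q" "q < 1"
      using ereal_dense2 by (metis ereal_less(3) one_ereal_def less_ereal.simps(1))
    have "ereal (1 - q) \<le> upper_density (- D)"
      unfolding upper_density_ge_iff
    proof (intro allI impI, rule ccontr)
      fix e :: real and N :: nat
      assume "e > 0" and "\<not> (\<exists>n\<ge>N. (1 - q - e) * real n < real (card (- D \<inter> {1..n})))"
      then have *: "real n - real (card (D \<inter> {1..n})) \<le> (1 - q - e) * real n" if "n \<ge> N" for n
        using that unfolding card_compl by force
      have "ereal q \<le> lower_density D"
        unfolding lower_density_def
      proof (intro Liminf_bounded eventually_sequentiallyI[of "max N 1"])
        fix n assume n: "max N 1 \<le> n"
        have "0 \<le> e * real n" using \<open>e > 0\<close> by simp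
        with *[of n] n have "q * real n \<le> real (card (D \<inter> {1..n}))" by (simp add: algebra_simps)
        with n show "ereal q \<le> ereal (real (card (D \<inter> {1..n})) / real n)"
          by (simp add: le_divide_eq)
      qed
      with q show False by simp
    qed
    with q show "\<exists>\<beta>>0. ereal \<beta> \<le> upper_density (- D)"
      by (intro exI[of _ "1 - q"]) simp
  next
    assume "\<exists>\<beta>>0. ereal \<beta> \<le> upper_density (- D)"
    then obtain \<beta> where \<beta>: "\<beta> > 0" "ereal \<beta> \<le> upper_density (- D)" by blast
    show "lower_density D < 1"
    proof (rule ccontr)
      assume "\<not> lower_density D < 1"
      with \<beta> have "ereal (1 - \<beta> / 2) < lower_density D"
        by (metis diff_less_eq ereal_less(3) less_add_same_cancel1 half_gt_zero less_ereal.simps(1)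
            less_le_trans not_less one_ereal_def)
      then have "eventually (\<lambda>n. ereal (1 - \<beta> / 2) < ereal (real (card (D \<inter> {1..n})) / real n)) sequentially"
        unfolding lower_density_def by (rule less_LiminfD)
      then obtain N where N: "\<And>n. n \<ge> N \<Longrightarrow> 1 - \<beta> / 2 < real (card (D \<inter> {1..n})) / real n"
        by (auto simp: eventually_sequentially)
      obtain n where n: "n \<ge> max N 1" "(\<beta> - \<beta> / 2) * real n < real (card (- D \<inter> {1..n}))"
        using \<beta> half_gt_zero[OF \<beta>(1)] unfolding upper_density_ge_iff by blast
      then have "(1 - \<beta> / 2) * real n < real (card (D \<inter> {1..n}))"
        using N[of n] by (simp add: less_divide_eq)
      with n(2) show False unfolding card_compl by (simp add: algebra_simps)
    qed
  qed
qed

section \<open>Extreme values of the Banach densities\<close>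

lemma lim_eventually_const:
  fixes L :: "nat \<Rightarrow> ereal"
  assumes "\<And>n. n \<ge> 1 \<Longrightarrow> L n = c"
  shows "lim L = c"
  by (intro limI tendsto_eventually eventually_sequentiallyI[of 1] assms)

text \<open>Used in contraposition, like the next lemma: lower Banach density 0 yields infinitely
  many times outside \<open>D\<close>, and upper Banach density 1 infinitely many in it.\<close>

lemma lower_Banach_density_cofinite:
  assumes "finite (- D)" shows "lower_Banach_density D = 1"
  unfolding lower_Banach_density_def
proof (rule lim_eventually_const)
  fix n :: nat assume n: "n \<ge> 1"
  obtain N where N: "\<And>j. j \<in> - D \<Longrightarrow> j < N"
    using assms by (auto simp: finite_nat_set_iff_bounded)
  have "(\<lambda>m. ereal (real (card (D \<inter> {m+1..m+n})) / real n)) \<longlonglongrightarrow> 1"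
  proof (intro tendsto_eventually eventually_sequentiallyI[of N])
    fix m assume "N \<le> m"
    then have "D \<inter> {m+1..m+n} = {m+1..m+n}" using N by fastforce
    then show "ereal (real (card (D \<inter> {m+1..m+n})) / real n) = 1"
      using n by (simp flip: one_ereal_def)
  qed
  then show "liminf (\<lambda>m. ereal (real (card (D \<inter> {m+1..m+n})) / real n)) = 1"
    by (intro lim_imp_Liminf) auto
qed

lemma upper_Banach_density_finite:
  assumes "finite D" shows "upper_Banach_density D = 0"
  unfolding upper_Banach_density_def
proof (rule lim_eventually_const)
  fix n :: nat
  obtain N where N: "\<And>j. j \<in> D \<Longrightarrow> j < N"
    using assms by (auto simp: finite_nat_set_iff_bounded)
  have "(\<lambda>m. ereal (real (card (D \<inter> {m+1..m+n})) / real n)) \<longlonglongrightarrow> 0"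
  proof (intro tendsto_eventually eventually_sequentiallyI[of N])
    fix m assume "N \<le> m"
    then have "D \<inter> {m+1..m+n} = {}" using N by fastforce
    then show "ereal (real (card (D \<inter> {m+1..m+n})) / real n) = 0" by simp
  qed
  then show "limsup (\<lambda>m. ereal (real (card (D \<inter> {m+1..m+n})) / real n)) = 0"
    by (intro lim_imp_Limsup) auto
qed

text \<open>Gaps of every length, arbitrarily late, make each inner \<open>liminf\<close> vanish.
  The next lemma is the dual statement for long runs; irregular orbits provide both.\<close>

lemma lower_Banach_density_eq_0:
  assumes "\<And>n N. \<exists>m\<ge>N. D \<inter> {m+1..m+n} = {}"
  shows "lower_Banach_density D = 0"
  unfolding lower_Banach_density_def
proof (rule lim_eventually_const)
  fix n :: nat
  let ?L = "\<lambda>m. ereal (real (card (D \<inter> {m+1..m+n})) / real n)"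
  have "liminf ?L \<le> 0"
  proof (rule ccontr)
    assume "\<not> ?thesis"
    then have "eventually (\<lambda>m. 0 < ?L m) sequentially" by (intro less_LiminfD) simp
    then obtain N where "\<And>m. m \<ge> N \<Longrightarrow> 0 < ?L m" by (auto simp: eventually_sequentially)
    moreover obtain m where "m \<ge> N" "D \<inter> {m+1..m+n} = {}" using assms by blast
    ultimately have "0 < ?L m" "D \<inter> {m+1..m+n} = {}" by blast+
    then show False by simp
  qed
  moreover have "0 \<le> liminf ?L" by (intro Liminf_bounded) auto
  ultimately show "liminf ?L = 0" by simp
qed

lemma upper_Banach_density_eq_1:
  assumes "\<And>n N. \<exists>m\<ge>N. {m+1..m+n} \<subseteq> D"
  shows "upper_Banach_density D = 1"
  unfolding upper_Banach_density_def
proof (rule lim_eventually_const)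
  fix n :: nat assume n: "n \<ge> 1"
  let ?L = "\<lambda>m. ereal (real (card (D \<inter> {m+1..m+n})) / real n)"
  have "1 \<le> limsup ?L"
  proof (rule ccontr)
    assume "\<not> ?thesis"
    then have "eventually (\<lambda>m. ?L m < 1) sequentially" by (intro Limsup_lessD) simp
    then obtain N where "\<And>m. m \<ge> N \<Longrightarrow> ?L m < 1" by (auto simp: eventually_sequentially)
    moreover obtain m where "m \<ge> N" "{m+1..m+n} \<subseteq> D" using assms by blast
    ultimately have "?L m < 1" "D \<inter> {m+1..m+n} = {m+1..m+n}" by blast+
    then show False using n by (simp flip: one_ereal_def)
  qed
  moreover have "limsup ?L \<le> 1"
  proof (intro Limsup_bounded always_eventually allI)
    fix m
    have "card (D \<inter> {m+1..m+n}) \<le> card {m+1..m+n}" by (intro card_mono) auto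
    then show "?L m \<le> 1" using n by (simp flip: one_ereal_def)
  qed
  ultimately show "limsup ?L = 1" by simp
qed

section \<open>Generic points\<close>

text \<open>\<open>Y\<close> need not be complete, so Baire's theorem is applied in its closure,
  where a set dense in \<open>Y\<close> is still dense. The point obtained may lie outside
  \<open>Y\<close>; every property wanted of it must therefore be encoded in \<U>.\<close>

lemma Baire_dense_subset:
  fixes Y :: "'a::banach set"
  assumes "countable \<U>" and "\<And>U. U \<in> \<U> \<Longrightarrow> open U" and "\<And>U. U \<in> \<U> \<Longrightarrow> Y \<subseteq> closure (Y \<inter> U)"
    and "Y \<noteq> {}"
  shows "\<Inter>\<U> \<noteq> {}"
proof -
  let ?Z = "closure Y"
  have "completely_metrizable_space (top_of_set ?Z)"
    by (intro completely_metrizable_space_closedin completely_metrizable_space_euclidean) auto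
  then obtain M d where "Metric_space M d" and comp: "Metric_space.mcomplete M d"
    and eq: "top_of_set ?Z = Metric_space.mtopology M d"
    unfolding completely_metrizable_space_def by blast
  interpret Metric_space M d by fact
  have M: "M = ?Z"
    by (metis eq topspace_euclidean_subtopology topspace_mtopology)
  have "mtopology closure_of \<Inter>((\<inter>) ?Z ` \<U>) = M"
  proof (rule metric_Baire_category[OF comp])
    fix T assume "T \<in> (\<inter>) ?Z ` \<U>"
    then obtain U where U: "U \<in> \<U>" "T = ?Z \<inter> U" by blast
    have "Y \<inter> U \<subseteq> T" using U closure_subset by auto
    with assms(3)[OF U(1)] have "Y \<subseteq> closure T" by (meson closure_mono order_trans)
    then have "?Z \<subseteq> closure T" by (simp add: closure_minimal)
    moreover have "T \<subseteq> ?Z" using U by auto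
    ultimately have "openin (top_of_set ?Z) T \<and> top_of_set ?Z closure_of T = ?Z"
      using U assms(2)[OF U(1)] by (auto simp: closure_of_subtopology openin_open Int_absorb1)
    then show "openin mtopology T \<and> mtopology closure_of T = M"
      by (simp only: eq M)
  qed (use assms(1) in auto)
  moreover have "M \<noteq> {}" using assms(4) M by simp
  ultimately have "\<Inter>((\<inter>) ?Z ` \<U>) \<noteq> {}" by (metis closure_of_empty)
  then obtain z where z: "\<And>U. U \<in> \<U> \<Longrightarrow> z \<in> U" by blast
  then show ?thesis by blast
qed

text \<open>The count exceeds \<open>r\<close> exactly if all conditions in some
  \<open>J \<subseteq> I\<close> with more than \<open>r\<close> elements hold, which gives a union
  of finite intersections of open sets.\<close>

lemma open_card_gt:
  assumes "finite I" and "\<And>j. j \<in> I \<Longrightarrow> open {y. P j y}"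
  shows "open {y. r < real (card ({j. P j y} \<inter> I))}"
proof -
  have "{y. r < real (card ({j. P j y} \<inter> I))} =
        (\<Union>J\<in>{J \<in> Pow I. r < real (card J)}. \<Inter>j\<in>J. {y. P j y})"
  proof (intro set_eqI iffI)
    fix y assume "y \<in> {y. r < real (card ({j. P j y} \<inter> I))}"
    then show "y \<in> (\<Union>J\<in>{J \<in> Pow I. r < real (card J)}. \<Inter>j\<in>J. {y. P j y})"
      by (intro UN_I[of "{j. P j y} \<inter> I"]) auto
  next
    fix y assume "y \<in> (\<Union>J\<in>{J \<in> Pow I. r < real (card J)}. \<Inter>j\<in>J. {y. P j y})"
    then obtain J where J: "J \<subseteq> I" "r < real (card J)" "\<And>j. j \<in> J \<Longrightarrow> P j y" by auto
    then have "card J \<le> card ({j. P j y} \<inter> I)"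
      using assms(1) by (intro card_mono) auto
    with J show "y \<in> {y. r < real (card ({j. P j y} \<inter> I))}" by simp
  qed
  also have "open \<dots>"
    using assms finite_subset by (intro open_UN ballI open_INT) blast+
  finally show ?thesis .
qed

lemma pigeonhole_disjoint:
  assumes "finite I" "I \<noteq> {}" "finite S" "disjoint_family_on B I" "\<And>i. i \<in> I \<Longrightarrow> B i \<subseteq> S"
  shows "\<exists>i\<in>I. card I * card (B i) \<le> card S"
proof (rule ccontr)
  assume "\<not> ?thesis"
  then have "(\<Sum>i\<in>I. card S) < (\<Sum>i\<in>I. card I * card (B i))"
    using assms by (intro sum_strict_mono) auto
  also have "\<dots> = card I * (\<Sum>i\<in>I. card (B i))" by (simp add: sum_distrib_left)
  also have "(\<Sum>i\<in>I. card (B i)) = card (\<Union>i\<in>I. B i)"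
    using assms(1,4) finite_subset[OF assms(5) assms(3)]
    by (subst card_UN_disjoint) (auto simp: disjoint_family_on_def)
  also have "\<dots> \<le> card S" using assms by (intro card_mono) auto
  finally show False by simp
qed

lemma eventually_sequentially_in:
  "eventually P (sequentially_in A) \<longleftrightarrow> finite {j \<in> A. \<not> P j}"
  unfolding eventually_inf_principal cofinite_eq_sequentially[symmetric] eventually_cofinite
  by (simp add: not_imp)

section \<open>Amplifying the proportion of escape times\<close>

text \<open>
  The interval after the last element \<open>i\<close> of \<open>G\<close> up to \<open>N\<close> either misses \<open>B'\<close> or is long enough
  for the density bound, and it is disjoint from \<open>G\<close>.
\<close>
lemma card_excursions_le:
  fixes G B B' :: "nat set" and b :: real
  assumes "0 \<in> G" "B' \<inter> G = {}" "B' \<subseteq> B" "b \<ge> 0"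
    and dens: "\<And>i M. i \<in> G \<Longrightarrow> M \<ge> M0 \<Longrightarrow> real (card (B \<inter> {i+1..i+M})) \<le> b * real M"
    and late: "\<And>i j. i \<in> G \<Longrightarrow> j \<in> B' \<Longrightarrow> i < j \<Longrightarrow> i + M0 \<le> j"
  shows "real (card (B' \<inter> {1..N})) \<le> b * real (card ({1..N} - G))"
proof (induction N rule: less_induct)
  case (less N)
  show ?case
  proof (cases "N = 0")
    case False
    define i where "i = Max (G \<inter> {..N})"
    have "i \<in> G \<inter> {..N}" unfolding i_def using assms(1) by (intro Max_in) auto
    then have i: "i \<in> G" "i \<le> N" by auto
    have notG: "j \<notin> G" if "i < j" "j \<le> N" for j
      using that Max_ge[of "G \<inter> {..N}" j] unfolding i_def[symmetric] by fastforce
    have "B' \<inter> {1..N} \<subseteq> (B' \<inter> {1..i-1}) \<union> (B' \<inter> {i+1..N})"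
    proof
      fix j assume j: "j \<in> B' \<inter> {1..N}"
      with i assms(2) have "j \<noteq> i" by blast
      with j show "j \<in> (B' \<inter> {1..i-1}) \<union> (B' \<inter> {i+1..N})" by auto
    qed
    then have "card (B' \<inter> {1..N}) \<le> card (B' \<inter> {1..i-1}) + card (B' \<inter> {i+1..N})"
      by (meson card_Un_le card_mono finite_Int finite_Un finite_atLeastAtMost order_trans)
    moreover have "real (card (B' \<inter> {1..i-1})) \<le> b * real (card ({1..i-1} - G))"
      using False i by (intro less.IH) auto
    moreover have "real (card (B' \<inter> {i+1..N})) \<le> b * real (N - i)"
    proof (cases "B' \<inter> {i+1..N} = {}")
      case True
      then show ?thesis using assms(4) by (metis card.empty mult_nonneg_nonneg of_nat_0 of_nat_0_le_iff)
    next
      case False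
      then obtain j where "j \<in> B'" "i < j" "j \<le> N" by (auto simp: Suc_le_eq)
      with late i have "M0 \<le> N - i" by fastforce
      from dens[OF i(1) this] i have "real (card (B \<inter> {i+1..N})) \<le> b * real (N - i)" by simp
      moreover have "card (B' \<inter> {i+1..N}) \<le> card (B \<inter> {i+1..N})"
        using assms(3) by (intro card_mono) auto
      ultimately show ?thesis by linarith
    qed
    moreover have "card ({1..i-1} - G) + (N - i) \<le> card ({1..N} - G)"
    proof -
      have "card ({1..i-1} - G) + (N - i) = card (({1..i-1} - G) \<union> {i+1..N})"
        by (subst card_Un_disjoint) auto
      also have "\<dots> \<le> card ({1..N} - G)"
        using i notG by (intro card_mono) auto
      finally show ?thesis .
    qed
    then have "b * (real (card ({1..i-1} - G)) + real (N - i)) \<le> b * real (card ({1..N} - G))"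
      using assms(4) by (intro mult_left_mono) linarith+
    ultimately show ?thesis by (simp add: algebra_simps)
  qed simp
qed

section \<open>Iterates of a bounded operator and their escape times\<close>

context
  fixes T :: "'a::banach \<Rightarrow> 'a"
  assumes T: "bounded_linear T"
begin

lemma bounded_linear_funpow: "bounded_linear (T ^^ n)"
proof (induction n)
  case (Suc n)
  then show ?case using bounded_linear_compose[OF T] by (simp add: comp_def)
qed (simp add: bounded_linear_ident id_def)

lemmas funpow_linear =
  linear_add[OF bounded_linear.linear[OF bounded_linear_funpow]]
  linear_diff[OF bounded_linear.linear[OF bounded_linear_funpow]]
  linear_cmul[OF bounded_linear.linear[OF bounded_linear_funpow]]

lemma open_norm_funpow_less: "open {y. norm ((T ^^ n) y) < r}"
  and open_norm_funpow_greater: "open {y. r < norm ((T ^^ n) y)}"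
proof -
  have "continuous_on UNIV (\<lambda>y. norm ((T ^^ n) y))"
    by (intro continuous_on_norm linear_continuous_on bounded_linear_funpow)
  then show "open {y. norm ((T ^^ n) y) < r}" "open {y. r < norm ((T ^^ n) y)}"
    by (auto intro!: open_Collect_less continuous_intros)
qed

text \<open>Taking \<open>K \<ge> 1\<close> makes the bound monotone in the exponent, so that a
  number of steps may be replaced by an upper bound for it.\<close>

lemma norm_funpow_le:
  obtains K where "K \<ge> 1" "\<And>n y. norm ((T ^^ n) y) \<le> K ^ n * norm y"
proof -
  obtain K where K: "\<And>x. norm (T x) \<le> norm x * K"
    using bounded_linear.bounded[OF T] by blast
  define L where "L = max K 1"
  have L: "norm (T x) \<le> L * norm x" for x
    using K[of x] mult_left_mono[of K L "norm x"] by (simp add: L_def mult.commute)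
  have "norm ((T ^^ n) y) \<le> L ^ n * norm y" for n y
  proof (induction n)
    case (Suc n)
    have "norm ((T ^^ Suc n) y) \<le> L * norm ((T ^^ n) y)" using L by simp
    also have "\<dots> \<le> L * (L ^ n * norm y)"
      using Suc by (intro mult_left_mono) (auto simp: L_def)
    finally show ?case by (simp add: mult.assoc)
  qed simp
  then show ?thesis using that[of L] by (simp add: L_def)
qed

text \<open>The bound is uniform over the unit ball of \<open>V\<close>, with one threshold
  \<open>M0\<close> for all vectors; this is what allows it to be applied afresh to any rescaled
  orbit point.\<close>

definition escape_bound :: "'a set \<Rightarrow> nat \<Rightarrow> real \<Rightarrow> real \<Rightarrow> bool" where
  "escape_bound V M0 C a \<longleftrightarrow> (\<forall>y\<in>V. norm y \<le> 1 \<longrightarrow>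
     (\<forall>M\<ge>M0. real (card ({j. C < norm ((T ^^ j) y)} \<inter> {1..M})) \<le> a * real M))"

text \<open>
  Restart the orbit, rescaled to norm at most \<open>1\<close>, at each time at which its norm drops to \<open>C1\<close>:
  since \<open>norm T \<le> K\<close>, reaching the top level takes more than \<open>M0\<close> further steps, so that the bound
  \<open>b\<close> applies to the excursion, while all excursions together occupy a proportion at most \<open>a\<close>.
\<close>
lemma escape_bound_mult:
  assumes K: "K \<ge> 1" "\<And>n y. norm ((T ^^ n) y) \<le> K ^ n * norm y"
    and V: "\<And>y. y \<in> V \<Longrightarrow> T y \<in> V" "\<And>y s. y \<in> V \<Longrightarrow> s *\<^sub>R y \<in> V"
    and C: "C1 \<ge> 1" "C2 \<ge> 1" and "b \<ge> 0"
    and bounds: "escape_bound V M0 C1 a" "escape_bound V M0 C2 b"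
  shows "escape_bound V M0 (C1 * C2 * K ^ M0) (b * a)"
  unfolding escape_bound_def
proof (intro ballI allI impI)
  fix y M assume y: "y \<in> V" "norm y \<le> 1" and M: "M \<ge> M0"
  let ?r = "\<lambda>j. norm ((T ^^ j) y)"
  let ?G = "{j. ?r j \<le> C1}" and ?B = "{j. C1 * C2 < ?r j}"
  let ?B' = "{j. C1 * C2 * K ^ M0 < ?r j}"
  have KM: "K ^ n \<ge> 1" for n using K(1) by (rule one_le_power)
  have TV: "(T ^^ j) y \<in> V" for j
    by (induction j) (use y V in auto)
  have C12: "C1 \<le> C1 * C2" using C by (metis mult_left_mono mult.right_neutral order_trans zero_le_one)
  have C123: "C1 * C2 \<le> C1 * C2 * K ^ M0"
    using C KM[of M0] by (metis C12 mult_left_mono mult.right_neutral order_trans zero_le_one)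
  have "real (card (?B' \<inter> {1..M})) \<le> b * real (card ({1..M} - ?G))"
  proof (rule card_excursions_le)
    show "0 \<in> ?G" using y C by simp
    show "?B' \<inter> ?G = {}" "?B' \<subseteq> ?B" using C12 C123 by auto
    fix i assume i: "i \<in> ?G"
    show "real (card (?B \<inter> {i+1..i+L})) \<le> b * real L" if L: "L \<ge> M0" for L
    proof -
      \<comment> \<open>At a time in \<open>?G\<close> the norm is at most \<open>C1\<close>, so
        \<open>z\<close> lies in the unit ball, and level \<open>C1 * C2\<close> for
        \<open>y\<close> becomes level \<open>C2\<close> for \<open>z\<close>.\<close>
      define z where "z = (1 / C1) *\<^sub>R (T ^^ i) y"
      have "z \<in> V" "norm z \<le> 1" using TV V i C by (auto simp: z_def)
      with bounds(2) L have "real (card ({j. C2 < norm ((T ^^ j) z)} \<inter> {1..L})) \<le> b * real L"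
        by (auto simp: escape_bound_def)
      moreover have "norm ((T ^^ j) z) = ?r (j + i) / C1" for j
        using C by (simp add: z_def funpow_linear funpow_add)
      then have "?B \<inter> {i+1..i+L} = (\<lambda>j. j + i) ` ({j. C2 < norm ((T ^^ j) z)} \<inter> {1..L})"
      proof (intro set_eqI iffI)
        fix j assume eq: "\<And>j. norm ((T ^^ j) z) = ?r (j + i) / C1" and j: "j \<in> ?B \<inter> {i+1..i+L}"
        then have "j - i \<in> {j. C2 < norm ((T ^^ j) z)} \<inter> {1..L}"
          using C by (auto simp: less_divide_eq mult.commute)
        moreover have "j = (j - i) + i" using j by auto
        ultimately show "j \<in> (\<lambda>j. j + i) ` ({j. C2 < norm ((T ^^ j) z)} \<inter> {1..L})" by blast
      qed (use C in \<open>auto simp: less_divide_eq mult.commute\<close>)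
      then have "card (?B \<inter> {i+1..i+L}) = card ({j. C2 < norm ((T ^^ j) z)} \<inter> {1..L})"
        by (simp add: card_image)
      ultimately show ?thesis by simp
    qed
    show "i + M0 \<le> j" if "j \<in> ?B'" "i < j" for j
    proof (rule ccontr)
      assume "\<not> i + M0 \<le> j"
      then have le: "j - i \<le> M0" by simp
      have "(T ^^ j) y = (T ^^ (j - i)) ((T ^^ i) y)"
        using \<open>i < j\<close> funpow_add[of "j - i" i T] by simp
      then have "?r j \<le> K ^ (j - i) * ?r i" using K(2) by metis
      also have "\<dots> \<le> K ^ M0 * C1"
        using i le K(1) C KM by (intro mult_mono power_increasing) (auto intro: order_trans[OF zero_le_one])
      also have "\<dots> \<le> C1 * C2 * K ^ M0"
        using mult_right_mono[OF C12, of "K ^ M0"] KM[of M0] by (simp add: mult.commute)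
      finally show False using that by simp
    qed
  qed fact
  also have "{1..M} - ?G = {j. C1 < ?r j} \<inter> {1..M}" by auto
  also have "b * real (card \<dots>) \<le> b * (a * real M)"
    using bounds(1) y M \<open>b \<ge> 0\<close> by (intro mult_left_mono) (auto simp: escape_bound_def)
  finally show "real (card (?B' \<inter> {1..M})) \<le> b * a * real M" by simp
qed

text \<open>A bound \<open>q < 1\<close> at some level would give, by repeated multiplication, the
  bounds \<open>q ^ n\<close> at higher levels with the same \<open>M0\<close>, eventually at most
  \<open>\<beta>\<close>.\<close>

lemma escape_proportion_amplify:
  assumes V: "\<And>y. y \<in> V \<Longrightarrow> T y \<in> V" "\<And>y s. y \<in> V \<Longrightarrow> s *\<^sub>R y \<in> V"
    and "\<beta> > 0" and esc: "\<And>C M0. \<not> escape_bound V M0 C \<beta>"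
    and q: "0 \<le> q" "q < 1"
  shows "\<not> escape_bound V M0 C q"
proof
  assume "escape_bound V M0 C q"
  \<comment> \<open>Multiplication of bounds requires levels at least 1; raising the level preserves
    the bound.\<close>
  then have bd: "escape_bound V M0 (max C 1) q"
    unfolding escape_bound_def
  proof (intro ballI allI impI)
    fix y M assume *: "\<forall>y\<in>V. norm y \<le> 1 \<longrightarrow>
     (\<forall>M\<ge>M0. real (card ({j. C < norm ((T ^^ j) y)} \<inter> {1..M})) \<le> q * real M)" "y \<in> V" "norm y \<le> 1" "M0 \<le> M"
    have "card ({j. max C 1 < norm ((T ^^ j) y)} \<inter> {1..M}) \<le> card ({j. C < norm ((T ^^ j) y)} \<inter> {1..M})"
      by (intro card_mono) auto
    with * show "real (card ({j. max C 1 < norm ((T ^^ j) y)} \<inter> {1..M})) \<le> q * real M"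
      by (meson of_nat_mono order_trans)
  qed
  obtain K where K: "K \<ge> 1" "\<And>n y. norm ((T ^^ n) y) \<le> K ^ n * norm y"
    using norm_funpow_le by blast
  have "\<exists>C'\<ge>1. escape_bound V M0 C' (q ^ Suc k)" for k
  proof (induction k)
    case 0
    then show ?case using bd by (intro exI[of _ "max C 1"]) simp
  next
    case (Suc k)
    then obtain C' where C': "C' \<ge> 1" "escape_bound V M0 C' (q ^ Suc k)" by blast
    have "escape_bound V M0 (C' * max C 1 * K ^ M0) (q * q ^ Suc k)"
      using K V C' bd q by (intro escape_bound_mult) auto
    moreover have "1 \<le> C' * max C 1 * K ^ M0"
      using C' K(1) by (intro mult_ge1_I one_le_power) auto
    ultimately show ?case by auto
  qed
  moreover obtain n where n: "q ^ n < \<beta>" using real_arch_pow_inv[OF \<open>\<beta> > 0\<close> q(2)] by blast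
  have "q ^ Suc n \<le> q ^ n" using q by (intro power_decreasing) auto
  ultimately obtain C' where "escape_bound V M0 C' (q ^ Suc n)" "q ^ Suc n \<le> \<beta>"
    using n by (meson less_imp_le order_trans)
  then have "escape_bound V M0 C' \<beta>"
    unfolding escape_bound_def by (meson mult_right_mono of_nat_0_le_iff order_trans)
  with esc show False by blast
qed

section \<open>Irregular vectors\<close>

text \<open>In \<open>large\<close> no late time is demanded: the iterates before \<open>N\<close>
  are bounded by the sum of their norms, so exceeding that sum as well forces a time beyond
  \<open>N\<close>.\<close>

lemma irregular_vectorI:
  assumes small: "\<And>e N. e > 0 \<Longrightarrow> \<exists>n\<ge>N. norm ((T ^^ n) x) < e"
    and large: "\<And>C. \<exists>n. C < norm ((T ^^ n) x)"
  shows "irregular_vector T x"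
proof -
  let ?r = "\<lambda>n. ereal (norm ((T ^^ n) x))"
  have "liminf ?r \<le> ereal e" if "e > 0" for e
  proof (rule ccontr)
    assume "\<not> ?thesis"
    then have "eventually (\<lambda>n. ereal e < ?r n) sequentially"
      by (intro less_LiminfD) simp
    then obtain N where "\<And>n. n \<ge> N \<Longrightarrow> e < norm ((T ^^ n) x)"
      by (auto simp: eventually_sequentially)
    with small[OF that, of N] show False by force
  qed
  then have "liminf ?r \<le> 0"
    by (metis add_0 ereal_le_epsilon2 zero_ereal_def)
  moreover have "0 \<le> liminf ?r" by (intro Liminf_bounded) auto
  moreover have "ereal C \<le> limsup ?r" for C
  proof (rule ccontr)
    assume "\<not> ?thesis"
    then have "eventually (\<lambda>n. ?r n < ereal C) sequentially"
      by (intro Limsup_lessD) simp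
    then obtain N where N: "\<And>n. n \<ge> N \<Longrightarrow> norm ((T ^^ n) x) < C"
      by (auto simp: eventually_sequentially)
    obtain n where n: "max C (\<Sum>i<N. norm ((T ^^ i) x)) < norm ((T ^^ n) x)"
      using large by blast
    with N[of n] have "n < N" by (cases "n < N") auto
    then have "norm ((T ^^ n) x) \<le> (\<Sum>i<N. norm ((T ^^ i) x))"
      by (intro member_le_sum) auto
    with n show False by simp
  qed
  then have "limsup ?r = \<infinity>" by (rule ereal_top)
  ultimately show ?thesis by (simp add: irregular_vector_def)
qed

lemma irregular_vectorD:
  assumes "irregular_vector T x"
  shows "e > 0 \<Longrightarrow> \<exists>n\<ge>N. norm ((T ^^ n) x) < e" "\<exists>n\<ge>N. C < norm ((T ^^ n) x)"
proof -
  let ?r = "\<lambda>n. ereal (norm ((T ^^ n) x))"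
  show "\<exists>n\<ge>N. norm ((T ^^ n) x) < e" if "e > 0"
  proof (rule ccontr)
    assume "\<not> ?thesis"
    then have "ereal e \<le> liminf ?r"
      by (intro Liminf_bounded eventually_sequentiallyI[of N]) force
    with assms \<open>e > 0\<close> show False by (simp add: irregular_vector_def)
  qed
  show "\<exists>n\<ge>N. C < norm ((T ^^ n) x)"
  proof (rule ccontr)
    assume "\<not> ?thesis"
    then have "limsup ?r \<le> ereal C"
      by (intro Limsup_bounded eventually_sequentiallyI[of N]) force
    with assms show False by (simp add: irregular_vector_def)
  qed
qed

text \<open>A filter covers both uses: convergence along a set of times for types 1 and
  \<open>1\<^sup>+\<close>, and along a subsequence for type 2.\<close>

definition null_vectors :: "nat filter \<Rightarrow> 'a set" where
  "null_vectors F = {y. ((\<lambda>n. (T ^^ n) y) \<longlongrightarrow> 0) F}"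

lemma null_vectors_add: "y \<in> null_vectors F \<Longrightarrow> z \<in> null_vectors F \<Longrightarrow> y + z \<in> null_vectors F"
  unfolding null_vectors_def mem_Collect_eq funpow_linear by (rule tendsto_add_zero)

lemma null_vectors_scaleR: "y \<in> null_vectors F \<Longrightarrow> s *\<^sub>R y \<in> null_vectors F"
  unfolding null_vectors_def mem_Collect_eq funpow_linear by (auto intro!: tendsto_eq_intros)

lemma null_vectors_funpow: "y \<in> null_vectors F \<Longrightarrow> (T ^^ m) y \<in> null_vectors F"
proof -
  assume "y \<in> null_vectors F"
  then have "((\<lambda>n. (T ^^ m) ((T ^^ n) y)) \<longlongrightarrow> (T ^^ m) 0) F"
    unfolding null_vectors_def by (auto intro: bounded_linear.tendsto[OF bounded_linear_funpow])
  moreover have "(T ^^ m) ((T ^^ n) y) = (T ^^ n) ((T ^^ m) y)" for n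
    by (metis add.commute comp_apply funpow_add)
  moreover have "(T ^^ m) 0 = 0"
    by (rule linear_0[OF bounded_linear.linear[OF bounded_linear_funpow]])
  ultimately show ?thesis by (simp add: null_vectors_def)
qed

text \<open>A small vector of the orbit of \<open>u\<close>, rescaled, serves as perturbation.\<close>
lemma unbounded_dense:
  assumes u: "u \<in> null_vectors F"
    and small: "\<And>e N. e > 0 \<Longrightarrow> \<exists>n\<ge>N. norm ((T ^^ n) u) < e"
    and large: "\<epsilon> > 0" "\<And>N. \<exists>n\<ge>N. \<epsilon> \<le> norm ((T ^^ n) u)"
  shows "null_vectors F \<subseteq> closure (null_vectors F \<inter> {y. \<exists>n. C < norm ((T ^^ n) y)})"
proof (rule subsetI, unfold closure_approachable, intro allI impI)
  fix y0 and e :: real assume y0: "y0 \<in> null_vectors F" and "e > 0"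
  define C' where "C' = max C 1"
  \<comment> \<open>Scaling by \<open>e / d\<close> turns norm below \<open>d\<close> into norm
    below \<open>e\<close>, and norm at least \<open>\<epsilon>\<close> into norm at least
    \<open>4 * C'\<close>.\<close>
  define d where "d = e * \<epsilon> / (4 * C')"
  have "d > 0" using \<open>e > 0\<close> large(1) by (auto simp: d_def C'_def)
  obtain m where m: "norm ((T ^^ m) u) < d" using small[OF \<open>d > 0\<close>] by blast
  obtain n where n: "n \<ge> m" "\<epsilon> \<le> norm ((T ^^ n) u)" using large(2) by blast
  define y where "y = (e / d) *\<^sub>R (T ^^ m) u"
  have "y \<in> null_vectors F" unfolding y_def by (intro null_vectors_scaleR null_vectors_funpow u)
  have "norm y < e" using m \<open>d > 0\<close> \<open>e > 0\<close> by (simp add: y_def field_simps)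
  have "(T ^^ (n - m)) ((T ^^ m) u) = (T ^^ n) u"
    using n(1) funpow_add[of "n - m" m T] by simp
  then have "norm ((T ^^ (n - m)) y) = e / d * norm ((T ^^ n) u)"
    using \<open>e > 0\<close> \<open>d > 0\<close> by (simp add: y_def funpow_linear)
  also have "\<dots> \<ge> e / d * \<epsilon>"
    using n \<open>e > 0\<close> \<open>d > 0\<close> by (intro mult_left_mono) auto
  also have "e / d * \<epsilon> = 4 * C'"
    using \<open>e > 0\<close> large(1) by (simp add: d_def C'_def)
  finally have "4 * C' \<le> norm ((T ^^ (n - m)) (y0 + y) - (T ^^ (n - m)) y0)"
    by (simp add: funpow_linear)
  also have "\<dots> \<le> norm ((T ^^ (n - m)) (y0 + y)) + norm ((T ^^ (n - m)) y0)"
    by (rule norm_triangle_ineq4)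
  \<comment> \<open>One of two norms with sum at least \<open>4 * C'\<close> exceeds
    \<open>C\<close>, so either the perturbed vector or \<open>y0\<close> itself will do.\<close>
  finally have "C < norm ((T ^^ (n - m)) (y0 + y)) \<or> C < norm ((T ^^ (n - m)) y0)"
    by (auto simp: C'_def)
  then show "\<exists>z\<in>null_vectors F \<inter> {y. \<exists>n. C < norm ((T ^^ n) y)}. dist z y0 < e"
  proof
    assume "C < norm ((T ^^ (n - m)) (y0 + y))"
    then show ?thesis
      using null_vectors_add[OF y0 \<open>y \<in> null_vectors F\<close>] \<open>norm y < e\<close>
      by (intro bexI[of _ "y0 + y"]) (auto simp: dist_norm)
  next
    assume "C < norm ((T ^^ (n - m)) y0)"
    then show ?thesis using y0 \<open>e > 0\<close> by (intro bexI[of _ y0]) auto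
  qed
qed

text \<open>
  Of \<open>m\<close> perturbations by well-separated multiples of an escaping vector, at most one is small at
  each escape time, so some perturbation is small at a proportion at most \<open>1 / m\<close> of these times.
\<close>
lemma large_proportion_dense:
  assumes V: "\<And>y z. y \<in> V \<Longrightarrow> z \<in> V \<Longrightarrow> y + z \<in> V" "\<And>y s. y \<in> V \<Longrightarrow> s *\<^sub>R y \<in> V"
    and esc: "\<And>C M0 q. 0 \<le> q \<Longrightarrow> q < 1 \<Longrightarrow> \<not> escape_bound V M0 C q"
  shows "V \<subseteq> closure (V \<inter> {y. \<exists>n\<ge>k. (1 - 1 / (real k + 1)) * real n
           < real (card ({j. real k < norm ((T ^^ j) y)} \<inter> {1..n}))})" (is "_ \<subseteq> closure (V \<inter> ?W)")
proof (rule subsetI, unfold closure_approachable, intro allI impI)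
  fix y0 and e :: real assume y0: "y0 \<in> V" and "e > 0"
  \<comment> \<open>\<open>2 / m = 1 / (k + 1)\<close> splits the loss between non-escape times and
    bad times; \<open>d\<close> keeps all \<open>m\<close> perturbations within \<open>e\<close>;
    \<open>C\<close> separates two of them by at least \<open>2 * (k + 1)\<close> at escape times,
    so they cannot both have norm at most \<open>k\<close>.\<close>
  define m where "m = 2 * (k + 1)"
  define d where "d = e / real (m + 1)"
  define C where "C = 2 * (real k + 1) / d"
  have "d > 0" using \<open>e > 0\<close> by (simp add: d_def)
  obtain y M where y: "y \<in> V" "norm y \<le> 1" and "M \<ge> k"
    and M: "(1 - 1 / real m) * real M < real (card ({j. C < norm ((T ^^ j) y)} \<inter> {1..M}))"
    using esc[of "1 - 1 / real m" k C] by (auto simp: escape_bound_def m_def not_le)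
  define z where "z i = y0 + (real i * d) *\<^sub>R y" for i :: nat
  define bad where "bad i = {j. C < norm ((T ^^ j) y) \<and> norm ((T ^^ j) (z i)) \<le> real k} \<inter> {1..M}" for i
  have "\<exists>i\<in>{1..m}. card {1..m} * card (bad i) \<le> card {1..M}"
  proof (rule pigeonhole_disjoint)
    show "disjoint_family_on bad {1..m}"
      unfolding disjoint_family_on_def
    proof (intro ballI impI, rule ccontr)
      fix i i' assume "i \<noteq> i'" "bad i \<inter> bad i' \<noteq> {}"
      then obtain j where j: "C < norm ((T ^^ j) y)" "norm ((T ^^ j) (z i)) \<le> real k"
        "norm ((T ^^ j) (z i')) \<le> real k" by (auto simp: bad_def)
      have "2 * (real k + 1) = d * C" using \<open>d > 0\<close> by (simp add: C_def)
      also have "\<dots> \<le> \<bar>real i - real i'\<bar> * (d * C)"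
        using \<open>i \<noteq> i'\<close> \<open>d > 0\<close> by (intro mult_le_cancel_right1[THEN iffD2]) (auto simp: C_def)
      also have "\<dots> \<le> \<bar>real i - real i'\<bar> * (d * norm ((T ^^ j) y))"
        using j(1) \<open>d > 0\<close> by (intro mult_left_mono) auto
      also have "\<dots> = norm ((T ^^ j) (z i) - (T ^^ j) (z i'))"
        using \<open>d > 0\<close> by (simp add: z_def funpow_linear abs_mult flip: scaleR_diff_left left_diff_distrib)
      also have "\<dots> \<le> norm ((T ^^ j) (z i)) + norm ((T ^^ j) (z i'))" by (rule norm_triangle_ineq4)
      finally show False using j by simp
    qed
  qed (auto simp: m_def bad_def)
  then obtain i where i: "i \<in> {1..m}" "m * card (bad i) \<le> M" by auto
  have "card ({j. C < norm ((T ^^ j) y)} \<inter> {1..M})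
      \<le> card (({j. real k < norm ((T ^^ j) (z i))} \<inter> {1..M}) \<union> bad i)"
    by (intro card_mono) (auto simp: bad_def)
  also have "\<dots> \<le> card ({j. real k < norm ((T ^^ j) (z i))} \<inter> {1..M}) + card (bad i)"
    by (rule card_Un_le)
  finally have 1: "real (card ({j. C < norm ((T ^^ j) y)} \<inter> {1..M}))
      \<le> real (card ({j. real k < norm ((T ^^ j) (z i))} \<inter> {1..M})) + real (card (bad i))"
    by linarith
  have "real m * real (card (bad i)) \<le> real M"
    using i(2) by (metis of_nat_le_iff of_nat_mult)
  then have 2: "real (card (bad i)) \<le> 1 / real m * real M"
    by (simp add: m_def field_simps)
  have "1 / (real k + 1) = 1 / real m + 1 / real m"
    by (simp add: m_def field_simps)
  then have "(1 - 1 / (real k + 1)) * real M = (1 - 1 / real m) * real M - 1 / real m * real M"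
    by (simp only: left_diff_distrib distrib_right)
  with M 1 2 have "(1 - 1 / (real k + 1)) * real M < real (card ({j. real k < norm ((T ^^ j) (z i))} \<inter> {1..M}))"
    by linarith
  with \<open>M \<ge> k\<close> have "z i \<in> ?W" by blast
  moreover have "z i \<in> V" unfolding z_def using V y0 y by blast
  moreover have "dist (z i) y0 < e"
  proof -
    have "dist (z i) y0 = real i * d * norm y" using \<open>d > 0\<close> by (simp add: z_def dist_norm)
    also have "\<dots> \<le> real i * d * 1" using y \<open>d > 0\<close> by (intro mult_left_mono) auto
    also have "\<dots> < real (m + 1) * d * 1" using i \<open>d > 0\<close> by simp
    also have "\<dots> = e" by (simp add: d_def)
    finally show ?thesis .
  qed
  ultimately show "\<exists>z\<in>V \<inter> ?W. dist z y0 < e" by blast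
qed

section \<open>Irregular vectors from Baire's theorem\<close>

lemma tendsto_0_sequentially_in_iff:
  "((\<lambda>n. (T ^^ n) y) \<longlongrightarrow> 0) (sequentially_in A) \<longleftrightarrow> (\<forall>e>0. finite (A - {j. norm ((T ^^ j) y) < e}))"
  by (auto simp: tendsto_iff eventually_sequentially_in set_diff_eq)

lemma irregular_vector_near_0:
  assumes "c > 0" and A: "ereal c \<le> upper_density A"
    and u: "((\<lambda>n. (T ^^ n) u) \<longlongrightarrow> 0) (sequentially_in A)"
    and large: "\<epsilon> > 0" "\<And>N. \<exists>n\<ge>N. \<epsilon> \<le> norm ((T ^^ n) u)"
  shows "\<exists>x B. irregular_vector T x \<and> ereal c \<le> upper_density B
    \<and> ((\<lambda>n. (T ^^ n) x) \<longlongrightarrow> 0) (sequentially_in B)"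
proof -
  define Y where "Y = null_vectors (sequentially_in A)"
  \<comment> \<open>Smallness along \<open>A\<close> is replaced by finite counts, which are open
    conditions that hold on all of \<open>Y\<close>.\<close>
  define U where "U k = {y. \<exists>n\<ge>k. (c - 1 / (real k + 1)) * real n
      < real (card ({j. norm ((T ^^ j) y) < 1 / (real k + 1)} \<inter> {1..n}))}" for k
  define V where "V k = {y. \<exists>n. real k < norm ((T ^^ n) y)}" for k
  have dens: "ereal c \<le> upper_density {j. norm ((T ^^ j) y) < e}" if "y \<in> Y" "e > 0" for y e
    using that upper_density_ge_almost_mono[OF A]
    by (simp add: Y_def null_vectors_def tendsto_0_sequentially_in_iff)
  have small_of_dens: "\<exists>n\<ge>N. norm ((T ^^ n) y) < e"
    if "ereal c \<le> upper_density {j. norm ((T ^^ j) y) < e}" for y e N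
    using upper_density_pos_imp_infinite[OF _ that] \<open>c > 0\<close>
    by (auto simp: infinite_nat_iff_unbounded_le)
  have uY: "u \<in> Y" using u by (simp add: Y_def null_vectors_def)
  have "\<Inter>(range U \<union> range V) \<noteq> {}"
  proof (rule Baire_dense_subset)
    fix W assume W: "W \<in> range U \<union> range V"
    have "open (U k)" for k
    proof -
      have "U k = (\<Union>n\<in>{k..}. {y. (c - 1 / (real k + 1)) * real n
          < real (card ({j. norm ((T ^^ j) y) < 1 / (real k + 1)} \<inter> {1..n}))})"
        by (auto simp: U_def)
      also have "open \<dots>" by (intro open_UN ballI open_card_gt open_norm_funpow_less) auto
      finally show ?thesis .
    qed
    moreover have "open (V k)" for k
    proof -
      have "V k = (\<Union>n. {y. real k < norm ((T ^^ n) y)})" by (auto simp: V_def)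
      also have "open \<dots>" by (intro open_UN ballI open_norm_funpow_greater)
      finally show ?thesis .
    qed
    ultimately show "open W" using W by auto
    have "Y \<subseteq> U k" for k
    proof
      fix y assume "y \<in> Y"
      then have "ereal c \<le> upper_density {j. norm ((T ^^ j) y) < 1 / (real k + 1)}"
        by (intro dens) auto
      then show "y \<in> U k" unfolding upper_density_ge_iff U_def mem_Collect_eq
        by (elim allE impE) (auto intro: add_nonneg_pos)
    qed
    then have "Y \<subseteq> closure (Y \<inter> U k)" for k
      by (metis Int_absorb2 closure_subset)
    moreover have "Y \<subseteq> closure (Y \<inter> V k)" for k
      unfolding Y_def V_def
      using uY small_of_dens[OF dens[OF uY]] large unfolding Y_def by (rule unbounded_dense)
    ultimately show "Y \<subseteq> closure (Y \<inter> W)" using W by auto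
  qed (use uY in auto)
  then obtain x where x: "x \<in> \<Inter>(range U \<union> range V)" by blast
  have U: "x \<in> U k" and V: "x \<in> V k" for k using x by simp_all
  define S where "S k = {j. norm ((T ^^ j) x) < 1 / (real k + 1)}" for k
  have "antimono S"
  proof (rule antimonoI)
    fix k l :: nat assume "k \<le> l"
    then have "1 / (real l + 1) \<le> 1 / (real k + 1)" by (intro divide_left_mono) auto
    then show "S l \<subseteq> S k" by (auto simp: S_def)
  qed
  then have S: "ereal c \<le> upper_density (S k)" for k
    by (rule upper_density_ge_antimono) (use U in \<open>simp add: U_def S_def\<close>)
  \<comment> \<open>Since \<open>x\<close> need not belong to \<open>Y\<close>, its orbit may not be
    small along \<open>A\<close>; a new set of times is built from the densities of the
    \<open>S k\<close>.\<close>
  obtain B where B: "ereal c \<le> upper_density B" "\<And>k. finite (B - S k)"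
    using upper_density_diagonal[OF \<open>antimono S\<close> S] by blast
  have S_sub: "\<exists>k. S k \<subseteq> {j. norm ((T ^^ j) x) < e}" if "e > 0" for e
  proof -
    obtain k where "inverse (real (Suc k)) < e" using reals_Archimedean[OF \<open>e > 0\<close>] by blast
    then have "1 / (real k + 1) < e" by (simp add: inverse_eq_divide add.commute)
    then show ?thesis by (intro exI[of _ k]) (auto simp: S_def)
  qed
  have fin: "finite (B - {j. norm ((T ^^ j) x) < e})" if "e > 0" for e
    using S_sub[OF that] B(2) by (meson Diff_mono finite_subset order_refl)
  have "irregular_vector T x"
  proof (rule irregular_vectorI)
    show "\<exists>n\<ge>N. norm ((T ^^ n) x) < e" if "e > 0" for e N
      using fin[OF that] upper_density_ge_almost_mono[OF B(1)] by (intro small_of_dens) auto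
    show "\<exists>n. C < norm ((T ^^ n) x)" for C
    proof -
      obtain k :: nat where "C < real k" using reals_Archimedean2 by blast
      moreover obtain n where "real k < norm ((T ^^ n) x)" using V by (auto simp: V_def)
      ultimately show ?thesis by (meson less_trans)
    qed
  qed
  with B(1) fin show ?thesis unfolding tendsto_0_sequentially_in_iff by blast
qed

text \<open>Small iterates of \<open>u\<close>, rescaled to the unit ball, spend a proportion of
  about \<open>\<beta>\<close> above any level. Amplification raises it to any \<open>q < 1\<close>,
  which makes large escape proportions dense in \<open>Y\<close>.\<close>

lemma irregular_vector_distributionally_unbounded:
  assumes small: "\<And>e N. e > 0 \<Longrightarrow> \<exists>n\<ge>N. norm ((T ^^ n) u) < e"
    and \<beta>: "\<beta> > 0" "ereal \<beta> \<le> upper_density {j. \<epsilon> \<le> norm ((T ^^ j) u)}" and "\<epsilon> > 0"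
  shows "\<exists>x. irregular_vector T x \<and> distributionally_unbounded T x"
proof -
  have "\<exists>n. \<forall>k. norm ((T ^^ n k) u) < 1 / (real k + 1) \<and> k \<le> n k"
    using small by (intro choice allI) (metis add_nonneg_pos divide_pos_pos of_nat_0_le_iff zero_less_one)
  then obtain n where n: "\<And>k. norm ((T ^^ n k) u) < 1 / (real k + 1)" "\<And>k. k \<le> n k" by blast
  define Y where "Y = null_vectors (filtermap n sequentially)"
  have Y_iff: "y \<in> Y \<longleftrightarrow> (\<lambda>k. (T ^^ n k) y) \<longlonglongrightarrow> 0" for y
    by (simp add: Y_def null_vectors_def filterlim_filtermap)
  have uY: "u \<in> Y"
    unfolding Y_iff
  proof (rule Lim_null_comparison)
    show "\<forall>\<^sub>F k in sequentially. norm ((T ^^ n k) u) \<le> 1 / (real k + 1)"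
      using n(1) by (intro always_eventually allI less_imp_le)
    show "(\<lambda>k. 1 / (real k + 1)) \<longlonglongrightarrow> 0"
      using LIMSEQ_inverse_real_of_nat by (simp add: inverse_eq_divide add.commute)
  qed
  note Y_closed = null_vectors_add[where F = "filtermap n sequentially", folded Y_def]
    null_vectors_scaleR[where F = "filtermap n sequentially", folded Y_def]
    null_vectors_funpow[where F = "filtermap n sequentially", folded Y_def]
  have "\<not> escape_bound Y M0 C (\<beta> / 2)" for M0 C
  proof
    assume bd: "escape_bound Y M0 C (\<beta> / 2)"
    define C' where "C' = max C 1"
    have "\<epsilon> / (2 * C') > 0" using \<open>\<epsilon> > 0\<close> by (simp add: C'_def)
    \<comment> \<open>\<open>p\<close> is chosen so that scaling by
      \<open>2 * C' / \<epsilon>\<close> keeps \<open>T ^^ p\<close> of \<open>u\<close> in the unit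
      ball and lifts norms at least \<open>\<epsilon>\<close> to at least \<open>2 * C'\<close>,
      hence above \<open>C\<close>.\<close>
    then obtain p where p: "norm ((T ^^ p) u) < \<epsilon> / (2 * C')" using small by blast
    define y where "y = (2 * C' / \<epsilon>) *\<^sub>R (T ^^ p) u"
    have "y \<in> Y" unfolding y_def by (intro Y_closed uY)
    have "norm y \<le> 1" using p \<open>\<epsilon> > 0\<close> by (simp add: y_def C'_def field_simps)
    \<comment> \<open>Beyond \<open>N\<close> the shift by \<open>p\<close> costs less than
      \<open>\<beta> / 4\<close> of the times; together with the error \<open>\<beta> / 4\<close> in
      the density this leaves more than \<open>\<beta> / 2\<close>.\<close>
    obtain N :: nat where N: "4 * real p / \<beta> < real N" using reals_Archimedean2 by blast
    obtain M where M: "M \<ge> max (max N (M0 + p)) 1"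
      "(\<beta> - \<beta> / 4) * real M < real (card ({j. \<epsilon> \<le> norm ((T ^^ j) u)} \<inter> {1..M}))"
      using \<beta> unfolding upper_density_ge_iff by (metis divide_pos_pos zero_less_numeral)
    have "{j. \<epsilon> \<le> norm ((T ^^ j) u)} \<inter> {1..M}
        \<subseteq> {1..p} \<union> (\<lambda>j. j + p) ` ({j. C < norm ((T ^^ j) y)} \<inter> {1..M})"
    proof
      fix j assume j: "j \<in> {j. \<epsilon> \<le> norm ((T ^^ j) u)} \<inter> {1..M}"
      show "j \<in> {1..p} \<union> (\<lambda>j. j + p) ` ({j. C < norm ((T ^^ j) y)} \<inter> {1..M})"
      proof (cases "j \<le> p")
        case False
        then have "(T ^^ (j - p)) ((T ^^ p) u) = (T ^^ j) u"
          using funpow_add[of "j - p" p T] by simp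
        then have "norm ((T ^^ (j - p)) y) = 2 * C' / \<epsilon> * norm ((T ^^ j) u)"
          using \<open>\<epsilon> > 0\<close> by (simp add: y_def funpow_linear C'_def)
        also have "\<dots> \<ge> 2 * C' / \<epsilon> * \<epsilon>"
          using j \<open>\<epsilon> > 0\<close> by (intro mult_left_mono) (auto simp: C'_def)
        finally have "C < norm ((T ^^ (j - p)) y)" using \<open>\<epsilon> > 0\<close> by (simp add: C'_def split: if_splits)
        with False j show ?thesis by (intro UnI2 image_eqI[of _ _ "j - p"]) auto
      qed (use j in auto)
    qed
    then have "card ({j. \<epsilon> \<le> norm ((T ^^ j) u)} \<inter> {1..M})
        \<le> card ({1..p} \<union> (\<lambda>j. j + p) ` ({j. C < norm ((T ^^ j) y)} \<inter> {1..M}))"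
      by (intro card_mono) auto
    also have "\<dots> \<le> p + card ({j. C < norm ((T ^^ j) y)} \<inter> {1..M})"
      by (rule order_trans[OF card_Un_le]) (simp add: card_image_le)
    finally have "(\<beta> - \<beta> / 4) * real M < real p + real (card ({j. C < norm ((T ^^ j) y)} \<inter> {1..M}))"
      using M(2) by linarith
    also have "real (card ({j. C < norm ((T ^^ j) y)} \<inter> {1..M})) \<le> \<beta> / 2 * real M"
      using bd \<open>y \<in> Y\<close> \<open>norm y \<le> 1\<close> M(1) unfolding escape_bound_def by auto
    finally have "\<beta> * real M < 4 * real p" by (simp add: algebra_simps)
    moreover have "4 * real p < \<beta> * real M"
    proof -
      have "4 * real p / \<beta> < real M" using N M(1) by linarith
      then show ?thesis using \<beta>(1) by (simp add: field_simps)
    qed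
    ultimately show False by simp
  qed
  moreover have "T y \<in> Y" if "y \<in> Y" for y using Y_closed(3)[OF that, of 1] by simp
  ultimately have esc: "\<not> escape_bound Y M0 C q" if "0 \<le> q" "q < 1" for M0 C q
    using escape_proportion_amplify[of Y "\<beta> / 2" q M0 C] Y_closed(2) \<beta>(1) that by simp
  define U where "U k = {y. \<exists>n\<ge>k. norm ((T ^^ n) y) < 1 / (real k + 1)}" for k
  define V where "V k = {y. \<exists>n\<ge>k. (1 - 1 / (real k + 1)) * real n
           < real (card ({j. real k < norm ((T ^^ j) y)} \<inter> {1..n}))}" for k
  have "\<Inter>(range U \<union> range V) \<noteq> {}"
  proof (rule Baire_dense_subset)
    fix W assume W: "W \<in> range U \<union> range V"
    have "open (U k)" for k
    proof -
      have "U k = (\<Union>n\<in>{k..}. {y. norm ((T ^^ n) y) < 1 / (real k + 1)})" by (auto simp: U_def)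
      also have "open \<dots>" by (intro open_UN ballI open_norm_funpow_less)
      finally show ?thesis .
    qed
    moreover have "open (V k)" for k
    proof -
      have "V k = (\<Union>n\<in>{k..}. {y. (1 - 1 / (real k + 1)) * real n
          < real (card ({j. real k < norm ((T ^^ j) y)} \<inter> {1..n}))})"
        by (auto simp: V_def)
      also have "open \<dots>" by (intro open_UN ballI open_card_gt open_norm_funpow_greater) auto
      finally show ?thesis .
    qed
    ultimately show "open W" using W by auto
    have "Y \<subseteq> U k" for k
    proof
      fix y assume "y \<in> Y"
      then have "\<forall>\<^sub>F i in sequentially. norm ((T ^^ n i) y) < 1 / (real k + 1)"
        unfolding Y_iff tendsto_iff by (auto intro: add_nonneg_pos)
      then obtain N where "norm ((T ^^ n (max N k)) y) < 1 / (real k + 1)"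
        unfolding eventually_sequentially by (metis max.cobounded1)
      moreover have "k \<le> n (max N k)" using n(2)[of "max N k"] by simp
      ultimately show "y \<in> U k" by (auto simp: U_def)
    qed
    then have "Y \<subseteq> closure (Y \<inter> U k)" for k
      by (metis Int_absorb2 closure_subset)
    moreover have "Y \<subseteq> closure (Y \<inter> V k)" for k
      unfolding V_def using Y_closed(1,2) esc by (rule large_proportion_dense)
    ultimately show "Y \<subseteq> closure (Y \<inter> W)" using W by auto
  qed (use uY in auto)
  then obtain x where x: "x \<in> \<Inter>(range U \<union> range V)" by blast
  have U: "x \<in> U k" and V: "x \<in> V k" for k using x by simp_all
  define S where "S k = {j. real k < norm ((T ^^ j) x)}" for k
  have "antimono S" by (intro antimonoI) (auto simp: S_def)
  then have S: "ereal 1 \<le> upper_density (S k)" for k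
    by (rule upper_density_ge_antimono) (use V in \<open>simp add: V_def S_def\<close>)
  obtain B where B: "ereal 1 \<le> upper_density B" "\<And>k. finite (B - S k)"
    using upper_density_diagonal[OF \<open>antimono S\<close> S] by blast
  have "filterlim (\<lambda>n. norm ((T ^^ n) x)) at_top (sequentially_in B)"
    unfolding filterlim_at_top eventually_sequentially_in
  proof
    fix Z :: real
    obtain k :: nat where k: "Z < real k" using reals_Archimedean2 by blast
    show "finite {j \<in> B. \<not> Z \<le> norm ((T ^^ j) x)}"
      by (rule finite_subset[OF _ B(2)[of k]]) (use k in \<open>auto simp: S_def\<close>)
  qed
  moreover have "upper_density B = 1"
    using B(1) upper_density_le_1[of B] by (simp flip: one_ereal_def)
  moreover have "irregular_vector T x"
  proof (rule irregular_vectorI)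
    show "\<exists>n\<ge>N. norm ((T ^^ n) x) < e" if "e > 0" for e N
    proof -
      obtain l where l: "inverse (real (Suc l)) < e" using reals_Archimedean[OF \<open>e > 0\<close>] by blast
      define k where "k = max l N"
      obtain n where "n \<ge> k" "norm ((T ^^ n) x) < 1 / (real k + 1)"
        using U by (auto simp: U_def)
      moreover have "1 / (real k + 1) \<le> inverse (real (Suc l))"
        by (simp add: k_def inverse_eq_divide frac_le)
      ultimately show ?thesis using l by (intro exI[of _ n]) (auto simp: k_def)
    qed
    show "\<exists>n. C < norm ((T ^^ n) x)" for C
    proof -
      obtain k :: nat where k: "C < real k" using reals_Archimedean2 by blast
      have "S k \<noteq> {}" using upper_density_pos_imp_infinite[OF _ S[of k]] by force
      then obtain n where "n \<in> S k" by blast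
      with k show ?thesis by (intro exI[of _ n]) (simp add: S_def)
    qed
  qed
  ultimately show ?thesis unfolding distributionally_unbounded_def by blast
qed

section \<open>Scrambled lines and close pairs\<close>

lemma close_times_eq: "close_times T x y \<delta> = {j. norm ((T ^^ j) (x - y)) < \<delta>}"
  by (simp add: close_times_def funpow_linear)

lemma uncountable_line:
  assumes "x \<noteq> (0 :: 'a)"
  shows "uncountable (range (\<lambda>t. t *\<^sub>R x))"
proof
  assume "countable (range (\<lambda>t. t *\<^sub>R x))"
  moreover have "inj (\<lambda>t. t *\<^sub>R x)" using assms by (auto intro: injI)
  ultimately show False using countable_image_inj_on uncountable_UNIV_real by blast
qed

text \<open>Two points of the line differ by a multiple of \<open>x\<close>, so only the threshold
  is rescaled. As the estimates for \<open>x\<close> hold at every threshold, a single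
  \<open>\<epsilon>\<close> serves all pairs.\<close>

lemma close_times_line:
  assumes "y \<in> range (\<lambda>t. t *\<^sub>R x)" "z \<in> range (\<lambda>t. t *\<^sub>R x)" "y \<noteq> z"
  obtains s where "s > 0" "\<And>\<delta>. close_times T y z \<delta> = {j. norm ((T ^^ j) x) < s * \<delta>}"
proof -
  obtain a b where ab: "y = a *\<^sub>R x" "z = b *\<^sub>R x" using assms by blast
  with assms have "a \<noteq> b" by auto
  have "norm ((T ^^ j) (y - z)) = \<bar>a - b\<bar> * norm ((T ^^ j) x)" for j
    unfolding ab scaleR_diff_left[symmetric] by (simp add: funpow_linear(3))
  then have "close_times T y z \<delta> = {j. norm ((T ^^ j) x) < 1 / \<bar>a - b\<bar> * \<delta>}" for \<delta>
    using \<open>a \<noteq> b\<close> by (simp add: close_times_eq less_divide_eq mult.commute)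
  with \<open>a \<noteq> b\<close> show ?thesis by (intro that[of "1 / \<bar>a - b\<bar>"]) auto
qed

lemma irregular_vector_nonzero: "irregular_vector T x \<Longrightarrow> x \<noteq> 0"
proof
  assume "irregular_vector T x" "x = 0"
  moreover have "(T ^^ n) 0 = 0" for n
    by (rule linear_0[OF bounded_linear.linear[OF bounded_linear_funpow]])
  ultimately show False using irregular_vectorD(2)[of x 0 0] by auto
qed

text \<open>The norm grows at most by the factor \<open>K\<close> per step, so a huge value at time
  \<open>p\<close> forces values at least \<open>s\<close> at the last \<open>n\<close> times up to
  \<open>p\<close>.\<close>

lemma irregular_vector_lower_Banach_density:
  assumes "irregular_vector T x" "s > 0"
  shows "lower_Banach_density {j. norm ((T ^^ j) x) < s} = 0"
proof (rule lower_Banach_density_eq_0)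
  fix n N :: nat
  obtain K where K: "K \<ge> 1" "\<And>n y. norm ((T ^^ n) y) \<le> K ^ n * norm y"
    using norm_funpow_le by blast
  obtain p where p: "p \<ge> N + n" "K ^ n * s < norm ((T ^^ p) x)"
    using irregular_vectorD(2)[OF assms(1)] by blast
  have "s \<le> norm ((T ^^ j) x)" if j: "p - n + 1 \<le> j" "j \<le> p" for j
  proof (rule ccontr)
    assume less: "\<not> s \<le> norm ((T ^^ j) x)"
    have "(T ^^ p) x = (T ^^ (p - j)) ((T ^^ j) x)"
      using j funpow_add[of "p - j" j T] by simp
    then have "norm ((T ^^ p) x) \<le> K ^ (p - j) * norm ((T ^^ j) x)" using K(2) by metis
    also have "\<dots> \<le> K ^ n * s"
      using K(1) j less by (intro mult_mono power_increasing) auto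
    finally show False using p by simp
  qed
  then have "{j. norm ((T ^^ j) x) < s} \<inter> {p - n + 1..p - n + n} = {}"
    using p(1) by (auto simp: not_less[symmetric])
  with p(1) show "\<exists>m\<ge>N. {j. norm ((T ^^ j) x) < s} \<inter> {m+1..m+n} = {}"
    by (intro exI[of _ "p - n"]) simp
qed

text \<open>After a value below \<open>s / K ^ n\<close> the orbit stays below \<open>s\<close> for
  \<open>n\<close> steps.\<close>

lemma irregular_vector_upper_Banach_density:
  assumes "irregular_vector T x" "s > 0"
  shows "upper_Banach_density {j. norm ((T ^^ j) x) < s} = 1"
proof (rule upper_Banach_density_eq_1)
  fix n N :: nat
  obtain K where K: "K \<ge> 1" "\<And>n y. norm ((T ^^ n) y) \<le> K ^ n * norm y"
    using norm_funpow_le by blast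
  have "K ^ n > 0" using K(1) by simp
  then obtain m where m: "m \<ge> N" "norm ((T ^^ m) x) < s / K ^ n"
    using irregular_vectorD(1)[OF assms(1), of "s / K ^ n" N] assms(2) by auto
  have "norm ((T ^^ j) x) < s" if j: "m + 1 \<le> j" "j \<le> m + n" for j
  proof -
    have "(T ^^ j) x = (T ^^ (j - m)) ((T ^^ m) x)"
      using j funpow_add[of "j - m" m T] by simp
    then have "norm ((T ^^ j) x) \<le> K ^ (j - m) * norm ((T ^^ m) x)" using K(2) by metis
    also have "\<dots> \<le> K ^ n * norm ((T ^^ m) x)"
      using K(1) j by (intro mult_right_mono power_increasing) auto
    also have "\<dots> < s" using m(2) \<open>K ^ n > 0\<close> by (simp add: field_simps)
    finally show ?thesis .
  qed
  with m show "\<exists>m\<ge>N. {m+1..m+n} \<subseteq> {j. norm ((T ^^ j) x) < s}" by auto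
qed

text \<open>Common core of types 1 and \<open>1\<^sup>+\<close>: diagonalising over shrinking radii
  yields one set of times along which the difference tends to 0.\<close>

lemma irregular_vector_near_0_of_pair:
  assumes "c > 0" "r > 0" "\<epsilon> > 0" "BF_lower T x y \<epsilon> = 0"
    and "\<And>\<delta>. 0 < \<delta> \<Longrightarrow> \<delta> < r \<Longrightarrow> ereal c \<le> F_upper T x y \<delta>"
  shows "\<exists>x B. irregular_vector T x \<and> ereal c \<le> upper_density B
    \<and> ((\<lambda>n. (T ^^ n) x) \<longlongrightarrow> 0) (sequentially_in B)"
proof -
  define u where "u = x - y"
  \<comment> \<open>The shift by 2 keeps every radius strictly below \<open>r\<close>, where the
    density bound is assumed.\<close>
  define S where "S k = {j. norm ((T ^^ j) u) < r / (real k + 2)}" for k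
  have "antimono S"
  proof (rule antimonoI)
    fix k l :: nat assume "k \<le> l"
    then have "r / (real l + 2) \<le> r / (real k + 2)" using \<open>r > 0\<close> by (intro divide_left_mono) auto
    then show "S l \<subseteq> S k" by (auto simp: S_def)
  qed
  moreover have "ereal c \<le> upper_density (S k)" for k
  proof -
    have "0 < r / (real k + 2)" "r / (real k + 2) < r"
      using \<open>r > 0\<close> by (simp_all add: divide_less_eq)
    from assms(5)[OF this] show ?thesis
      by (simp add: F_upper_def close_times_eq S_def u_def)
  qed
  ultimately obtain A where A: "ereal c \<le> upper_density A" "\<And>k. finite (A - S k)"
    using upper_density_diagonal by blast
  have "((\<lambda>n. (T ^^ n) u) \<longlongrightarrow> 0) (sequentially_in A)"
    unfolding tendsto_0_sequentially_in_iff
  proof (intro allI impI)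
    fix e :: real assume "e > 0"
    obtain k :: nat where "r / e < real k" using reals_Archimedean2 by blast
    then have "r / (real k + 2) < e" using \<open>e > 0\<close> by (simp add: field_simps)
    then show "finite (A - {j. norm ((T ^^ j) u) < e})"
      by (intro finite_subset[OF _ A(2)[of k]]) (auto simp: S_def)
  qed
  moreover have "\<exists>n\<ge>N. \<epsilon> \<le> norm ((T ^^ n) u)" for N
  proof (rule ccontr)
    assume "\<not> ?thesis"
    then have "- close_times T x y \<epsilon> \<subseteq> {..<N}"
      by (auto simp: close_times_eq u_def not_le not_less)
    then have "lower_Banach_density (close_times T x y \<epsilon>) = 1"
      by (intro lower_Banach_density_cofinite) (rule finite_subset, auto)
    with assms(4) show False by (simp add: BF_lower_def)
  qed
  ultimately show ?thesis using assms(1,3) A(1) by (intro irregular_vector_near_0)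
qed

lemma uncountable_obtain_pair:
  assumes "uncountable \<Gamma>" obtains x y where "x \<in> \<Gamma>" "y \<in> \<Gamma>" "x \<noteq> y"
proof -
  have "infinite \<Gamma>" using assms countable_finite by blast
  then obtain x where "x \<in> \<Gamma>" by (metis finite.emptyI ex_in_conv)
  moreover have "\<Gamma> - {x} \<noteq> {}" using \<open>infinite \<Gamma>\<close> by (metis finite.emptyI infinite_remove)
  ultimately show ?thesis using that by blast
qed

text \<open>The converse for types 1 and \<open>1\<^sup>+\<close>: rescaling the threshold does not
  affect convergence along \<open>A\<close>, so the same \<open>c\<close> works for all pairs and
  all \<open>\<delta>\<close>.\<close>

lemma scrambled_line:
  assumes x: "irregular_vector T x" and A: "ereal c \<le> upper_density A"
    and lim: "((\<lambda>n. (T ^^ n) x) \<longlongrightarrow> 0) (sequentially_in A)"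
    and yz: "y \<in> range (\<lambda>t. t *\<^sub>R x)" "z \<in> range (\<lambda>t. t *\<^sub>R x)" "y \<noteq> z" and "\<delta> > 0"
  shows "BF_lower T y z \<delta> = 0" "ereal c \<le> F_upper T y z \<delta>"
proof -
  obtain s where s: "s > 0" "\<And>\<delta>. close_times T y z \<delta> = {j. norm ((T ^^ j) x) < s * \<delta>}"
    using close_times_line[OF yz] by blast
  show "BF_lower T y z \<delta> = 0"
    using s \<open>\<delta> > 0\<close> x by (simp add: BF_lower_def irregular_vector_lower_Banach_density)
  show "ereal c \<le> F_upper T y z \<delta>"
    unfolding F_upper_def s(2)
    by (rule upper_density_ge_almost_mono[OF A])
       (use lim s(1) \<open>\<delta> > 0\<close> in \<open>simp add: tendsto_0_sequentially_in_iff\<close>)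
qed

section \<open>The three equivalences\<close>

lemma RDC_type_1_iff:
  "RDC_type_1 T \<longleftrightarrow> (\<exists>x A. irregular_vector T x \<and> upper_density A > 0 \<and>
     ((\<lambda>n. (T ^^ n) x) \<longlongrightarrow> 0) (sequentially_in A))"
proof
  assume "RDC_type_1 T"
  then obtain \<Gamma> \<epsilon> where \<Gamma>: "uncountable \<Gamma>" "\<epsilon> > 0" and
    pairs: "\<forall>x\<in>\<Gamma>. \<forall>y\<in>\<Gamma>. x \<noteq> y \<longrightarrow> BF_lower T x y \<epsilon> = 0 \<and>
       (\<exists>c>0::real. \<exists>r>0::real. \<forall>\<delta>. 0 < \<delta> \<and> \<delta> < r \<longrightarrow> ereal c \<le> F_upper T x y \<delta>)"
    unfolding RDC_type_1_def by (elim exE conjE)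
  obtain x y where "x \<in> \<Gamma>" "y \<in> \<Gamma>" "x \<noteq> y" by (rule uncountable_obtain_pair[OF \<Gamma>(1)])
  from pairs[rule_format, OF this] obtain c r where cr: "c > 0" "r > 0" "BF_lower T x y \<epsilon> = 0"
    "\<And>\<delta>. 0 < \<delta> \<Longrightarrow> \<delta> < r \<Longrightarrow> ereal c \<le> F_upper T x y \<delta>" by blast
  have "0 < ereal c" using cr(1) by simp
  then show "\<exists>x A. irregular_vector T x \<and> upper_density A > 0 \<and>
     ((\<lambda>n. (T ^^ n) x) \<longlongrightarrow> 0) (sequentially_in A)"
    using irregular_vector_near_0_of_pair[OF cr(1,2) \<Gamma>(2) cr(3,4)] by (meson less_le_trans)
next
  assume "\<exists>x A. irregular_vector T x \<and> upper_density A > 0 \<and>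
     ((\<lambda>n. (T ^^ n) x) \<longlongrightarrow> 0) (sequentially_in A)"
  then obtain x A where x: "irregular_vector T x" and A: "upper_density A > 0"
    and lim: "((\<lambda>n. (T ^^ n) x) \<longlongrightarrow> 0) (sequentially_in A)" by blast
  obtain c where c: "0 < ereal c" "ereal c < upper_density A" using ereal_dense2[OF A] by blast
  note line = scrambled_line[OF x less_imp_le[OF c(2)] lim]
  show "RDC_type_1 T"
    unfolding RDC_type_1_def
  proof (rule exI[of _ "range (\<lambda>t. t *\<^sub>R x)"], rule exI[of _ "1::real"], intro conjI ballI impI)
    show "uncountable (range (\<lambda>t. t *\<^sub>R x))"
      using x by (intro uncountable_line irregular_vector_nonzero)
    fix y z assume yz: "y \<in> range (\<lambda>t. t *\<^sub>R x)" "z \<in> range (\<lambda>t. t *\<^sub>R x)" "y \<noteq> z"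
    show "BF_lower T y z 1 = 0" using line(1)[OF yz] by simp
    show "\<exists>c>0::real. \<exists>r>0::real. \<forall>\<delta>. 0 < \<delta> \<and> \<delta> < r \<longrightarrow> ereal c \<le> F_upper T y z \<delta>"
      using line(2)[OF yz] c(1) by (intro exI[of _ c] conjI exI[of _ 1]) auto
  qed auto
qed

lemma RDC_type_1_plus_iff:
  "RDC_type_1_plus T \<longleftrightarrow> (\<exists>x. irregular_vector T x \<and> distributionally_near_0 T x)"
proof
  assume "RDC_type_1_plus T"
  then obtain \<Gamma> \<epsilon> where \<Gamma>: "uncountable \<Gamma>" "\<epsilon> > 0" and
    pairs: "\<forall>x\<in>\<Gamma>. \<forall>y\<in>\<Gamma>. x \<noteq> y \<longrightarrow> BF_lower T x y \<epsilon> = 0 \<and>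
       (\<forall>\<delta>>0. F_upper T x y \<delta> = 1)"
    unfolding RDC_type_1_plus_def by (elim exE conjE)
  obtain x y where "x \<in> \<Gamma>" "y \<in> \<Gamma>" "x \<noteq> y" by (rule uncountable_obtain_pair[OF \<Gamma>(1)])
  note xy = pairs[rule_format, OF this]
  have "\<exists>x B. irregular_vector T x \<and> ereal 1 \<le> upper_density B
    \<and> ((\<lambda>n. (T ^^ n) x) \<longlongrightarrow> 0) (sequentially_in B)"
    using xy \<Gamma>(2)
    by (intro irregular_vector_near_0_of_pair[of 1 1 \<epsilon> x y]) (auto simp flip: one_ereal_def)
  then show "\<exists>x. irregular_vector T x \<and> distributionally_near_0 T x"
    unfolding distributionally_near_0_def
    by (metis antisym one_ereal_def upper_density_le_1)
next
  assume "\<exists>x. irregular_vector T x \<and> distributionally_near_0 T x"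
  then obtain x A where x: "irregular_vector T x" and A: "upper_density A = 1"
    and lim: "((\<lambda>n. (T ^^ n) x) \<longlongrightarrow> 0) (sequentially_in A)"
    unfolding distributionally_near_0_def by blast
  have "ereal 1 \<le> upper_density A" using A by (simp flip: one_ereal_def)
  note line = scrambled_line[OF x this lim]
  show "RDC_type_1_plus T"
    unfolding RDC_type_1_plus_def
  proof (rule exI[of _ "range (\<lambda>t. t *\<^sub>R x)"], rule exI[of _ "1::real"], intro conjI ballI impI allI)
    show "uncountable (range (\<lambda>t. t *\<^sub>R x))"
      using x by (intro uncountable_line irregular_vector_nonzero)
    fix y z assume yz: "y \<in> range (\<lambda>t. t *\<^sub>R x)" "z \<in> range (\<lambda>t. t *\<^sub>R x)" "y \<noteq> z"
    show "BF_lower T y z 1 = 0" using line(1)[OF yz] by simp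
    show "F_upper T y z \<delta> = 1" if "\<delta> > 0" for \<delta>
      using line(2)[OF yz that] upper_density_le_1
      by (intro antisym) (simp_all add: F_upper_def flip: one_ereal_def)
  qed auto
qed

lemma RDC_type_2_iff:
  "RDC_type_2 T \<longleftrightarrow> (\<exists>x. irregular_vector T x \<and> distributionally_unbounded T x)"
proof
  assume "RDC_type_2 T"
  then obtain \<Gamma> \<epsilon> where \<Gamma>: "uncountable \<Gamma>" "\<epsilon> > 0" and
    pairs: "\<forall>x\<in>\<Gamma>. \<forall>y\<in>\<Gamma>. x \<noteq> y \<longrightarrow>
       (\<forall>\<delta>>0. BF_upper T x y \<delta> = 1) \<and> F_lower T x y \<epsilon> < 1"
    unfolding RDC_type_2_def by (elim exE conjE)
  obtain x y where "x \<in> \<Gamma>" "y \<in> \<Gamma>" "x \<noteq> y" by (rule uncountable_obtain_pair[OF \<Gamma>(1)])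
  note xy = pairs[rule_format, OF this]
  have "- close_times T x y \<epsilon> = {j. \<epsilon> \<le> norm ((T ^^ j) (x - y))}"
    by (auto simp: close_times_eq)
  with xy obtain \<beta> where \<beta>: "\<beta> > 0" "ereal \<beta> \<le> upper_density {j. \<epsilon> \<le> norm ((T ^^ j) (x - y))}"
    by (auto simp: F_lower_def lower_density_less_1_iff)
  show "\<exists>x. irregular_vector T x \<and> distributionally_unbounded T x"
  proof (rule irregular_vector_distributionally_unbounded[OF _ \<beta> \<Gamma>(2)])
    fix e :: real and N assume "e > 0"
    \<comment> \<open>A finite set of close times would have upper Banach density 0, so the orbit of
      the difference comes near 0 arbitrarily late.\<close>
    then have "upper_Banach_density {j. norm ((T ^^ j) (x - y)) < e} \<noteq> 0"
      using xy by (simp add: BF_upper_def close_times_eq)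
    then have "infinite {j. norm ((T ^^ j) (x - y)) < e}"
      using upper_Banach_density_finite by blast
    then show "\<exists>n\<ge>N. norm ((T ^^ n) (x - y)) < e"
      by (auto simp: infinite_nat_iff_unbounded_le)
  qed
next
  assume "\<exists>x. irregular_vector T x \<and> distributionally_unbounded T x"
  then obtain x B where x: "irregular_vector T x" and B: "upper_density B = 1"
    and lim: "filterlim (\<lambda>n. norm ((T ^^ n) x)) at_top (sequentially_in B)"
    unfolding distributionally_unbounded_def by blast
  show "RDC_type_2 T"
    unfolding RDC_type_2_def
  proof (rule exI[of _ "range (\<lambda>t. t *\<^sub>R x)"], rule exI[of _ "1::real"], intro conjI ballI impI allI)
    show "uncountable (range (\<lambda>t. t *\<^sub>R x))"
      using x by (intro uncountable_line irregular_vector_nonzero)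
    fix y z assume yz: "y \<in> range (\<lambda>t. t *\<^sub>R x)" "z \<in> range (\<lambda>t. t *\<^sub>R x)" "y \<noteq> z"
    obtain s where s: "s > 0" "\<And>\<delta>. close_times T y z \<delta> = {j. norm ((T ^^ j) x) < s * \<delta>}"
      using close_times_line[OF yz] by blast
    show "BF_upper T y z \<delta> = 1" if "\<delta> > 0" for \<delta>
      using s that x by (simp add: BF_upper_def irregular_vector_upper_Banach_density)
    \<comment> \<open>Along \<open>B\<close> the norms tend to infinity, so up to a finite set
      \<open>B\<close> avoids the close times for threshold 1.\<close>
    have "finite {j \<in> B. \<not> s \<le> norm ((T ^^ j) x)}"
      using lim unfolding filterlim_at_top eventually_sequentially_in by blast
    moreover have "B - (- close_times T y z 1) = {j \<in> B. \<not> s \<le> norm ((T ^^ j) x)}"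
      by (auto simp: s(2))
    moreover have "ereal 1 \<le> upper_density B" using B by (simp flip: one_ereal_def)
    ultimately have "ereal 1 \<le> upper_density (- close_times T y z 1)"
      using upper_density_ge_almost_mono by metis
    then show "F_lower T y z 1 < 1"
      unfolding F_lower_def lower_density_less_1_iff by (intro exI[of _ 1]) simp
  qed auto
qed

end

theorem theorem2p3:
  fixes T :: "'a::banach \<Rightarrow> 'a"
  assumes "bounded_linear T"
  shows "(RDC_type_1 T \<longleftrightarrow>
            (\<exists>x A. irregular_vector T x \<and> upper_density A > 0 \<and>
               ((\<lambda>n. (T ^^ n) x) \<longlongrightarrow> 0) (sequentially_in A))) \<and>
         (RDC_type_1_plus T \<longleftrightarrow>
            (\<exists>x. irregular_vector T x \<and> distributionally_near_0 T x)) \<and>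
         (RDC_type_2 T \<longleftrightarrow>
            (\<exists>x. irregular_vector T x \<and> distributionally_unbounded T x))"
  using RDC_type_1_iff[OF assms] RDC_type_1_plus_iff[OF assms] RDC_type_2_iff[OF assms]
  by (intro conjI)

end
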